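(* Let $d=3$, $p\in[1,\infty]$ and $\delta\in(0,\tilde\delta_0]$. Then (i) $\nabla\mathcal K_{\delta,0}^{\mathrm g}f=\mathcal K_{\delta,0}^{\mathrm c}\nabla f$ for all $f\in\widetilde Z^{\mathrm g,p}(D)$; (ii) $\nabla\times\mathcal K_{\delta,0}^{\mathrm c}\mathbf g=\mathcal K_{\delta,0}^{\mathrm d}\nabla\times\mathbf g$ for all $\mathbf g\in\widetilde{\mathbf Z}^{\mathrm c,p}(D)$; (iii) $\nabla\cdot\mathcal K_{\delta,0}^{\mathrm d}\mathbf g=\mathcal K_{\delta,0}^{\mathrm b}\nabla\cdot\mathbf g$ for all $\mathbf g\in\widetilde{\mathbf Z}^{\mathrm d,p}(D)$. That is, $\mathcal K_{\delta,0}^{\mathrm g},\mathcal K_{\delta,0}^{\mathrm c},\mathcal K_{\delta,0}^{\mathrm d},\mathcal K_{\delta,0}^{\mathrm b}$ form a commuting diagram from the complex $\widetilde Z^{\mathrm g,p}(D)\xrightarrow{\nabla}\widetilde{\mathbf Z}^{\mathrm c,p}(D)\xrightarrow{\nabla\times}\widetilde{\mathbf Z}^{\mathrm d,p}(D)\xrightarrow{\nabla\cdot}L^p(D)$ to the complex $C_0^\infty(D)\xrightarrow{\nabla}\mathbf C_0^\infty(D)\xrightarrow{\nabla\times}\mathbf C_0^\infty(D)\xrightarrow{\nabla\cdot}C_0^\infty(D)$.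
   Context: $D\subset\mathbb R^d$ ($d=3$) is an open, bounded, connected, strongly Lipschitz set. Boldface spaces are spaces of $\mathbb R^d$-valued fields; $C_0^\infty(D)$ denotes smooth functions with compact support in $D$. $B(\mathbf x,\rho)$ is the open Euclidean ball, $\|\cdot\|_{\ell^2}$ the Euclidean norm and induced matrix norm. Let $\mathbf x_D\in\mathbb R^d$, $r_D>0$ with $D\subset B(\mathbf x_D,r_D)$ be such that $\mathcal O:=B(\mathbf x_D,r_D)\setminus\overline D$ is a bounded open strongly Lipschitz set with $\partial D\subset\partial\mathcal O$. Let $\mathbf k\in C^\infty(\mathbb R^d;\mathbb R^d)$ be a fixed vector field, globally transversal for $\mathcal O$ and pointing outward $D$ (there is $\gamma>0$ with $-\mathbf n_{\mathcal O}\cdot\mathbf k\ge\gamma$ a.e. on $\partial\mathcal O$, $\mathbf n_{\mathcal O}$ the outward unit normal of $\mathcal O$), with $\|\mathbf k\|_{\ell^2}=1$ on $\partial\mathcal O$. Set $\boldsymbol\vartheta_\delta(\mathbf x)=\mathbf x+\delta\,\mathbf k(\mathbf x)$ and let $\zeta>0$ be fixed such that $\boldsymbol\vartheta_\delta(\mathcal O)+B(\mathbf 0,3\delta\zeta)\subset\mathcal O$ for all $\delta\in[0,1]$ (for $\delta=0$ the ball is understood as $\{\mathbf 0\}$). Let $\mathbb K_\delta(\mathbf x)$ be the Jacobian matrix of $\boldsymbol\vartheta_\delta$ at $\mathbf x\in D$, and let $\tilde\delta_0\in(0,1]$ be such that $\|\mathbb K_\delta-\mathbb I\|_{\ell^2}\le\frac12$,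 $\|\mathbb K_\delta^{-1}\|_{\ell^2}\le2$, $|\det(\mathbb K_\delta^{-1})|\le2^d$ on $D$ for all $\delta\in[0,\tilde\delta_0]$. The kernel is $\rho(\mathbf y)=\eta\exp\left(-\frac{1}{1-\|\mathbf y\|_{\ell^2}^2}\right)$ if $\|\mathbf y\|_{\ell^2}<1$, $0$ otherwise, with $\eta$ such that $\int_{\mathbb R^d}\rho=1$. $\widetilde g$ denotes the extension by zero of $g$ to $\mathbb R^d$. For $\mathbf x\in D$, $f\in L^1(D)$, $\mathbf g\in\mathbf L^1(D)$: $$(\mathcal K_{\delta,0}^{\mathrm g}f)(\mathbf x)=\int_{B(\mathbf 0,1)}\rho(\mathbf y)\widetilde f(\boldsymbol\vartheta_\delta(\mathbf x)+\delta\zeta\mathbf y)\,d\mathbf y,$$ $$(\mathcal K_{\delta,0}^{\mathrm c}\mathbf g)(\mathbf x)=\int_{B(\mathbf 0,1)}\rho(\mathbf y)\mathbb K_\delta^{\mathsf T}(\mathbf x)\widetilde{\mathbf g}(\boldsymbol\vartheta_\delta(\mathbf x)+\delta\zeta\mathbf y)\,d\mathbf y,$$ $$(\mathcal K_{\delta,0}^{\mathrm d}\mathbf g)(\mathbf x)=\int_{B(\mathbf 0,1)}\rho(\mathbf y)\det(\mathbb K_\delta(\mathbf x))\mathbb K_\delta^{-1}(\mathbf x)\widetilde{\mathbf g}(\boldsymbol\vartheta_\delta(\mathbf x)+\delta\zeta\mathbf y)\,d\mathbf y,$$ $$(\mathcal K_{\delta,0}^{\mathrm b}f)(\mathbf x)=\int_{B(\mathbf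 0,1)}\rho(\mathbf y)\det(\mathbb K_\delta(\mathbf x))\widetilde f(\boldsymbol\vartheta_\delta(\mathbf x)+\delta\zeta\mathbf y)\,d\mathbf y.$$ Spaces: $\widetilde Z^{\mathrm g,p}(D)=\{f\in L^p(D):\nabla\widetilde f\in\mathbf L^p(\mathbb R^d)\}$, $\widetilde{\mathbf Z}^{\mathrm c,p}(D)=\{\mathbf v\in\mathbf L^p(D):\nabla\times\widetilde{\mathbf v}\in\mathbf L^p(\mathbb R^d)\}$, $\widetilde{\mathbf Z}^{\mathrm d,p}(D)=\{\mathbf v\in\mathbf L^p(D):\nabla\cdot\widetilde{\mathbf v}\in L^p(\mathbb R^d)\}$. *)

theory Defs
  imports "HOL-Analysis.Analysis"
begin

text \<open>A function on an open set \<open>S\<close> is represented by a total HOL function of which only the values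
  on \<open>S\<close> matter; \<open>ext0 S\<close> is the extension by zero.\<close>

definition ext0 :: "'a set \<Rightarrow> ('a \<Rightarrow> 'b::zero) \<Rightarrow> 'a \<Rightarrow> 'b" where
  "ext0 S f = (\<lambda>x. if x \<in> S then f x else 0)"

section \<open>Smooth functions and classical differential operators\<close>

primrec Ck_on :: "nat \<Rightarrow> 'a::real_normed_vector set \<Rightarrow> ('a \<Rightarrow> 'b::real_normed_vector) \<Rightarrow> bool" where
  "Ck_on 0 S f \<longleftrightarrow> continuous_on S f"
| "Ck_on (Suc n) S f \<longleftrightarrow> (\<forall>x\<in>S. f differentiable (at x)) \<and>
     (\<forall>v. Ck_on n S (\<lambda>x. frechet_derivative f (at x) v))"

definition smooth_on :: "'a::real_normed_vector set \<Rightarrow> ('a \<Rightarrow> 'b::real_normed_vector) \<Rightarrow> bool" where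
  "smooth_on S f \<longleftrightarrow> (\<forall>n. Ck_on n S f)"

definition C0_infty :: "'a::real_normed_vector set \<Rightarrow> ('a \<Rightarrow> 'b::real_normed_vector) set" where
  "C0_infty S = {f. smooth_on S f \<and> (\<exists>C. compact C \<and> C \<subseteq> S \<and> (\<forall>x\<in>S - C. f x = 0))}"

definition grad :: "(real^3 \<Rightarrow> real) \<Rightarrow> real^3 \<Rightarrow> real^3" where
  "grad f x = (\<chi> i. frechet_derivative f (at x) (axis i 1))"

text \<open>Entry \<open>J $ i $ j\<close> of the Jacobian is the \<open>j\<close>-th partial derivative of the \<open>i\<close>-th component.\<close>

definition curl :: "(real^3 \<Rightarrow> real^3) \<Rightarrow> real^3 \<Rightarrow> real^3" where
  "curl g x = (let J = jacobian g (at x) in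
     vector [J $ 3 $ 2 - J $ 2 $ 3, J $ 1 $ 3 - J $ 3 $ 1, J $ 2 $ 1 - J $ 1 $ 2])"

definition divergence :: "(real^3 \<Rightarrow> real^3) \<Rightarrow> real^3 \<Rightarrow> real" where
  "divergence g x = (\<Sum>i\<in>UNIV. jacobian g (at x) $ i $ i)"

section \<open>Lebesgue spaces and weak derivatives\<close>

definition Lp :: "ennreal \<Rightarrow> 'a::euclidean_space set \<Rightarrow> ('a \<Rightarrow> 'b::euclidean_space) set" where
  "Lp p S = {f. f \<in> borel_measurable (lebesgue_on S) \<and>
     (if p = \<infinity> then \<exists>C. AE x in lebesgue_on S. norm (f x) \<le> C
      else integrable (lebesgue_on S) (\<lambda>x. norm (f x) powr enn2real p))}"

definition loc_integrable :: "'a::euclidean_space set \<Rightarrow> ('a \<Rightarrow> 'b::euclidean_space) \<Rightarrow> bool" where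
  "loc_integrable S f \<longleftrightarrow> (\<forall>C. compact C \<and> C \<subseteq> S \<longrightarrow> set_integrable lebesgue C f)"

text \<open>Weak derivatives are relations, since they are determined only almost everywhere.\<close>

definition weak_grad :: "(real^3) set \<Rightarrow> (real^3 \<Rightarrow> real) \<Rightarrow> (real^3 \<Rightarrow> real^3) \<Rightarrow> bool" where
  "weak_grad S f G \<longleftrightarrow> loc_integrable S f \<and> loc_integrable S G \<and>
     (\<forall>\<phi>\<in>C0_infty S. (LINT x:S|lebesgue. f x *\<^sub>R grad \<phi> x) = - (LINT x:S|lebesgue. \<phi> x *\<^sub>R G x))"

definition weak_curl :: "(real^3) set \<Rightarrow> (real^3 \<Rightarrow> real^3) \<Rightarrow> (real^3 \<Rightarrow> real^3) \<Rightarrow> bool" where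
  "weak_curl S g w \<longleftrightarrow> loc_integrable S g \<and> loc_integrable S w \<and>
     (\<forall>\<phi>\<in>C0_infty S. (LINT x:S|lebesgue. g x \<bullet> curl \<phi> x) = (LINT x:S|lebesgue. w x \<bullet> \<phi> x))"

definition weak_div :: "(real^3) set \<Rightarrow> (real^3 \<Rightarrow> real^3) \<Rightarrow> (real^3 \<Rightarrow> real) \<Rightarrow> bool" where
  "weak_div S g w \<longleftrightarrow> loc_integrable S g \<and> loc_integrable S w \<and>
     (\<forall>\<phi>\<in>C0_infty S. (LINT x:S|lebesgue. g x \<bullet> grad \<phi> x) = - (LINT x:S|lebesgue. w x * \<phi> x))"

definition Zg :: "ennreal \<Rightarrow> (real^3) set \<Rightarrow> (real^3 \<Rightarrow> real) set" where
  "Zg p D = {f \<in> Lp p D. \<exists>G\<in>Lp p UNIV. weak_grad UNIV (ext0 D f) G}"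

definition Zc :: "ennreal \<Rightarrow> (real^3) set \<Rightarrow> (real^3 \<Rightarrow> real^3) set" where
  "Zc p D = {g \<in> Lp p D. \<exists>w\<in>Lp p UNIV. weak_curl UNIV (ext0 D g) w}"

definition Zd :: "ennreal \<Rightarrow> (real^3) set \<Rightarrow> (real^3 \<Rightarrow> real^3) set" where
  "Zd p D = {g \<in> Lp p D. \<exists>w\<in>Lp p UNIV. weak_div UNIV (ext0 D g) w}"

section \<open>Strongly Lipschitz sets, normals and surface null sets\<close>

text \<open>Near each boundary point \<open>x0\<close>, inside a cylinder with axis direction \<open>N\<close>, the set is the
  strict epigraph (in direction \<open>N\<close>) of a Lipschitz function on the hyperplane orthogonal to \<open>N\<close>.\<close>

definition strongly_lipschitz :: "'a::euclidean_space set \<Rightarrow> bool" where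
  "strongly_lipschitz S \<longleftrightarrow> open S \<and> (\<forall>x0\<in>frontier S. \<exists>N \<phi> L b c.
     norm N = 1 \<and> b > 0 \<and> c > 0 \<and>
     L-lipschitz_on {h. h \<bullet> N = 0} \<phi> \<and> \<phi> 0 = (0::real) \<and>
     (\<forall>h. h \<bullet> N = 0 \<and> norm h \<le> b \<longrightarrow> \<bar>\<phi> h\<bar> < c / 2) \<and>
     (\<forall>h t. h \<bullet> N = 0 \<and> norm h < b \<and> \<bar>t\<bar> < c \<longrightarrow>
        (x0 + h + t *\<^sub>R N \<in> S \<longleftrightarrow> t > \<phi> h) \<and>
        (x0 + h + t *\<^sub>R N \<in> frontier S \<longleftrightarrow> t = \<phi> h) \<and>
        (x0 + h + t *\<^sub>R N \<notin> closure S \<longleftrightarrow> t < \<phi> h)))"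

text \<open>\<open>n\<close> is the outward unit normal of \<open>S\<close> at \<open>x\<close> if \<open>S\<close> is tangent at \<open>x\<close> to the half-space
  below the hyperplane through \<open>x\<close> orthogonal to \<open>n\<close>. If \<open>S\<close> is locally a Lipschitz epigraph, this
  says that the graph function is differentiable there and that \<open>n\<close> is the normalised vector given
  by its gradient.\<close>

definition outward_unit_normal :: "'a::euclidean_space set \<Rightarrow> 'a \<Rightarrow> 'a \<Rightarrow> bool" where
  "outward_unit_normal S x n \<longleftrightarrow> x \<in> frontier S \<and> norm n = 1 \<and>
     (\<forall>\<epsilon>>0. \<exists>r>0. \<forall>y. dist y x < r \<longrightarrow>
        ((y - x) \<bullet> n > \<epsilon> * norm (y - x) \<longrightarrow> y \<notin> S) \<and>
        ((y - x) \<bullet> n < - \<epsilon> * norm (y - x) \<longrightarrow> y \<in> S))"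

text \<open>Hausdorff outer measure, up to the normalising constant, which does not affect null sets.\<close>

definition hausdorff_pre :: "real \<Rightarrow> real \<Rightarrow> 'a::metric_space set \<Rightarrow> ennreal" where
  "hausdorff_pre s e A =
     (INF U\<in>{U :: nat \<Rightarrow> 'a set. A \<subseteq> (\<Union>n. U n) \<and> (\<forall>n. bounded (U n) \<and> diameter (U n) \<le> e)}.
        \<Sum>n. ennreal (diameter (U n) powr s))"

definition hausdorff_outer :: "real \<Rightarrow> 'a::metric_space set \<Rightarrow> ennreal" where
  "hausdorff_outer s A = (SUP e\<in>{0<..}. hausdorff_pre s e A)"

text \<open>The condition \<open>- n \<bullet> k x \<ge> \<gamma>\<close> holds at almost every boundary point with respect to surface
  measure; for a strongly Lipschitz \<open>S\<close> the normal exists at almost every boundary point.\<close>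

definition transversal_inward :: "(real^3) set \<Rightarrow> (real^3 \<Rightarrow> real^3) \<Rightarrow> bool" where
  "transversal_inward S k \<longleftrightarrow> (\<exists>\<gamma>>0. hausdorff_outer 2
     {x \<in> frontier S. \<exists>n. outward_unit_normal S x n \<and> \<not> - (n \<bullet> k x) \<ge> \<gamma>} = 0)"

section \<open>The mollification operators\<close>

definition mollifier :: "real \<Rightarrow> real^3 \<Rightarrow> real" where
  "mollifier \<eta> y = (if norm y < 1 then \<eta> * exp (- (1 / (1 - (norm y)\<^sup>2))) else 0)"

definition shrink :: "(real^3 \<Rightarrow> real^3) \<Rightarrow> real \<Rightarrow> real^3 \<Rightarrow> real^3" where
  "shrink k \<delta> x = x + \<delta> *\<^sub>R k x"

definition KK :: "(real^3 \<Rightarrow> real^3) \<Rightarrow> real \<Rightarrow> real^3 \<Rightarrow> real^3^3" where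
  "KK k \<delta> x = jacobian (shrink k \<delta>) (at x)"

text \<open>The norm of the type \<open>real^3^3\<close> is the Frobenius norm; the norm induced by the Euclidean
  vector norm is the operator norm below.\<close>

definition mat_norm :: "real^3^3 \<Rightarrow> real" where
  "mat_norm A = onorm (\<lambda>v. A *v v)"

definition Kg :: "real \<Rightarrow> real \<Rightarrow> (real^3 \<Rightarrow> real^3) \<Rightarrow> (real^3) set \<Rightarrow> real
    \<Rightarrow> (real^3 \<Rightarrow> real) \<Rightarrow> real^3 \<Rightarrow> real" where
  "Kg \<eta> \<zeta> k D \<delta> f x = (LINT y:ball 0 1|lebesgue.
     mollifier \<eta> y * ext0 D f (shrink k \<delta> x + (\<delta> * \<zeta>) *\<^sub>R y))"

definition Kc :: "real \<Rightarrow> real \<Rightarrow> (real^3 \<Rightarrow> real^3) \<Rightarrow> (real^3) set \<Rightarrow> real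
    \<Rightarrow> (real^3 \<Rightarrow> real^3) \<Rightarrow> real^3 \<Rightarrow> real^3" where
  "Kc \<eta> \<zeta> k D \<delta> g x = (LINT y:ball 0 1|lebesgue.
     mollifier \<eta> y *\<^sub>R (transpose (KK k \<delta> x) *v ext0 D g (shrink k \<delta> x + (\<delta> * \<zeta>) *\<^sub>R y)))"

definition Kd :: "real \<Rightarrow> real \<Rightarrow> (real^3 \<Rightarrow> real^3) \<Rightarrow> (real^3) set \<Rightarrow> real
    \<Rightarrow> (real^3 \<Rightarrow> real^3) \<Rightarrow> real^3 \<Rightarrow> real^3" where
  "Kd \<eta> \<zeta> k D \<delta> g x = (LINT y:ball 0 1|lebesgue.
     mollifier \<eta> y *\<^sub>R (det (KK k \<delta> x) *\<^sub>R
       (matrix_inv (KK k \<delta> x) *v ext0 D g (shrink k \<delta> x + (\<delta> * \<zeta>) *\<^sub>R y))))"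

definition Kb :: "real \<Rightarrow> real \<Rightarrow> (real^3 \<Rightarrow> real^3) \<Rightarrow> (real^3) set \<Rightarrow> real
    \<Rightarrow> (real^3 \<Rightarrow> real) \<Rightarrow> real^3 \<Rightarrow> real" where
  "Kb \<eta> \<zeta> k D \<delta> f x = (LINT y:ball 0 1|lebesgue.
     mollifier \<eta> y * (det (KK k \<delta> x) * ext0 D f (shrink k \<delta> x + (\<delta> * \<zeta>) *\<^sub>R y)))"

end

theory Submission
  imports Defs
begin

text \<open>After the change of variables \<open>z = \<theta> x + \<epsilon> y\<close> with \<open>\<theta> = shrink k \<delta>\<close> and \<open>\<epsilon> = \<delta> \<zeta>\<close>, each
  operator is the pull-back by \<open>\<theta>\<close> (of a function, a 1-form, a 2-form and a volume form) of a
  convolution with a scaled mollifier. A convolution turns a weak derivative on the whole space into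
  a classical one, and classical derivatives commute with pull-backs because second derivatives are
  symmetric. A weak derivative on \<open>D\<close> extends by zero to one on the whole space: by the
  fundamental lemma of the calculus of variations the given global derivative agrees with it on
  \<open>D\<close> and vanishes off the closure of \<open>D\<close>, and a Lipschitz boundary is a null set. The
  images have compact support because \<open>\<theta>\<close> moves a neighbourhood of the boundary of \<open>D\<close> into \<open>Om\<close>.\<close>

section \<open>Calculus of smooth functions\<close>

text \<open>The datum to be smoothed is merely an Lp function, so the dependence on x has to be
  moved entirely into the kernel. From then on only integrability of the datum counts, and on a
  bounded set this follows from every exponent p \<ge> 1. The real obstacle is the boundary: near it
  the averaging ball may straddle D and its complement, whereas the derivative is given only inside
  D. Membership in the Z spaces says that some global derivative is a function, so no surface layer
  sits on the boundary; this makes it legitimate to average the zero extension of the interior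
  derivative. The weights transpose(K), det(K) K^(-1) and det(K) are exactly those under which
  gradient, curl and divergence are natural. For the second one the cofactor form is used: it is
  polynomial in the first derivatives of the deformation, so smoothness of matrix inversion never
  has to be discussed. Second derivatives of the deformation cancel in the curl by symmetry and in
  the divergence by the Piola identity; the gradient sees only the chain rule.\<close>

lemma Ck_on_cong:
  assumes "open S" "Ck_on n S f" "\<And>x. x \<in> S \<Longrightarrow> f x = g x"
  shows "Ck_on n S g"
  using assms(2,3)
proof (induction n arbitrary: f g)
  case 0
  then show ?case by (simp cong: continuous_on_cong)
next
  case (Suc n)
  have der: "(g has_derivative frechet_derivative f (at x)) (at x)" if "x \<in> S" for x
  proof -
    have "(f has_derivative frechet_derivative f (at x)) (at x)"
      using Suc.prems that by (simp add: frechet_derivative_works)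
    then show ?thesis
      by (rule has_derivative_transform_within_open[OF _ \<open>open S\<close> that]) (use Suc.prems in auto)
  qed
  have eq: "frechet_derivative f (at x) = frechet_derivative g (at x)" if "x \<in> S" for x
    using frechet_derivative_at[OF der[OF that]] .
  have "Ck_on n S (\<lambda>x. frechet_derivative g (at x) v)" for v
    by (rule Suc.IH[of "\<lambda>x. frechet_derivative f (at x) v"]) (use Suc.prems(1) in \<open>simp_all add: eq\<close>)
  moreover have "g differentiable at x" if "x \<in> S" for x
    using der[OF that] differentiableI by blast
  ultimately show ?case by simp
qed

lemma Ck_on_subset: "Ck_on n S f \<Longrightarrow> T \<subseteq> S \<Longrightarrow> Ck_on n T f"
  by (induction n arbitrary: f) (auto intro: continuous_on_subset)

lemma Ck_on_Suc_imp: "Ck_on (Suc n) S f \<Longrightarrow> Ck_on n S f"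
proof (induction n arbitrary: f)
  case 0
  then show ?case
    by (auto intro!: continuous_at_imp_continuous_on differentiable_imp_continuous_within)
next
  case (Suc n)
  have "f differentiable at x" if "x \<in> S" for x
    using Suc.prems that by simp
  moreover have "Ck_on (Suc n) S (\<lambda>x. frechet_derivative f (at x) v)" for v
    using Suc.prems by (simp only: Ck_on.simps(2)[of "Suc n"])
  ultimately show ?case using Suc.IH by simp
qed

text \<open>Any derivative formula \<open>f'\<close> may be supplied, so the inductions below can
  use the ordinary calculus rules instead of computing \<open>frechet_derivative\<close>
  itself.\<close>

lemma Ck_on_SucI:
  assumes "open S" "\<And>x. x \<in> S \<Longrightarrow> (f has_derivative f' x) (at x)" "\<And>v. Ck_on n S (\<lambda>x. f' x v)"
  shows "Ck_on (Suc n) S f"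
proof -
  have "Ck_on n S (\<lambda>x. frechet_derivative f (at x) v)" for v
    by (rule Ck_on_cong[OF assms(1) assms(3)])
      (use frechet_derivative_at[OF assms(2)] in \<open>simp add: fun_eq_iff\<close>)
  moreover have "f differentiable at x" if "x \<in> S" for x
    using assms(2)[OF that] differentiableI by blast
  ultimately show ?thesis by simp
qed

lemma Ck_on_SucD:
  assumes "Ck_on (Suc n) S f"
  shows "x \<in> S \<Longrightarrow> (f has_derivative frechet_derivative f (at x)) (at x)"
    "Ck_on n S (\<lambda>x. frechet_derivative f (at x) v)"
  using assms by (simp_all add: frechet_derivative_works)

lemma Ck_on_const: "Ck_on n S (\<lambda>x. c)"
  by (induction n arbitrary: c) auto

lemma Ck_on_add:
  assumes "open S" shows "Ck_on n S f \<Longrightarrow> Ck_on n S g \<Longrightarrow> Ck_on n S (\<lambda>x. f x + g x)"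
proof (induction n arbitrary: f g)
  case 0
  then show ?case by (simp add: continuous_on_add)
next
  case (Suc n)
  show ?case
    by (rule Ck_on_SucI[OF assms has_derivative_add[OF Ck_on_SucD(1)[OF Suc.prems(1)] Ck_on_SucD(1)[OF Suc.prems(2)]]
          Suc.IH[OF Ck_on_SucD(2)[OF Suc.prems(1)] Ck_on_SucD(2)[OF Suc.prems(2)]]])
qed

lemma Ck_on_sum:
  assumes "open S" "\<And>i. i \<in> I \<Longrightarrow> Ck_on n S (f i)"
  shows "Ck_on n S (\<lambda>x. \<Sum>i\<in>I. f i x)"
  using assms(2)
  by (induction I rule: infinite_finite_induct) (auto intro: Ck_on_const Ck_on_add[OF assms(1)])

lemma Ck_on_bounded_linear:
  assumes "open S" "bounded_linear h"
  shows "Ck_on n S f \<Longrightarrow> Ck_on n S (\<lambda>x. h (f x))"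
proof (induction n arbitrary: f)
  case 0
  then show ?case using assms(2) by (auto intro: bounded_linear.continuous_on)
next
  case (Suc n)
  show ?case
    by (rule Ck_on_SucI[OF assms(1) bounded_linear.has_derivative[OF assms(2) Ck_on_SucD(1)[OF Suc.prems]]
          Suc.IH[OF Ck_on_SucD(2)[OF Suc.prems]]])
qed

text \<open>By the Leibniz rule the derivative again consists of values of \<open>h\<close>, with
  one argument differentiated and the other merely weakened from order n + 1 to order n.\<close>

lemma Ck_on_bilinear:
  assumes "open S" "bounded_bilinear h"
  shows "Ck_on n S f \<Longrightarrow> Ck_on n S g \<Longrightarrow> Ck_on n S (\<lambda>x. h (f x) (g x))"
proof (induction n arbitrary: f g)
  case 0
  then show ?case using assms(2) by (auto intro: bounded_bilinear.continuous_on)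
next
  case (Suc n)
  show ?case
    by (rule Ck_on_SucI[OF assms(1) bounded_bilinear.FDERIV[OF assms(2)
          Ck_on_SucD(1)[OF Suc.prems(1)] Ck_on_SucD(1)[OF Suc.prems(2)]]
          Ck_on_add[OF assms(1) Suc.IH[OF Ck_on_Suc_imp[OF Suc.prems(1)] Ck_on_SucD(2)[OF Suc.prems(2)]]
            Suc.IH[OF Ck_on_SucD(2)[OF Suc.prems(1)] Ck_on_Suc_imp[OF Suc.prems(2)]]]])
qed

text \<open>\<open>Ck_on\<close> controls derivatives only along fixed directions, whereas the chain
  rule applies the derivative of \<open>g\<close> to the moving direction \<open>?f' x v\<close>.
  Expanding that direction in a basis leaves scalar coefficients times derivatives of
  \<open>g\<close> along fixed basis vectors; this is why the intermediate space is
  Euclidean.\<close>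

lemma Ck_on_compose:
  fixes f :: "'a::real_normed_vector \<Rightarrow> 'b::euclidean_space" and g :: "'b \<Rightarrow> 'c::real_normed_vector"
  assumes "open S"
  shows "Ck_on n S f \<Longrightarrow> Ck_on n T g \<Longrightarrow> f ` S \<subseteq> T \<Longrightarrow> Ck_on n S (\<lambda>x. g (f x))"
proof (induction n arbitrary: g)
  case 0
  then show ?case by (auto intro: continuous_on_compose2)
next
  case (Suc n)
  let ?f' = "\<lambda>x. frechet_derivative f (at x)" and ?g' = "\<lambda>y. frechet_derivative g (at y)"
  have der: "((\<lambda>x. g (f x)) has_derivative (\<lambda>v. \<Sum>b\<in>Basis. (?f' x v \<bullet> b) *\<^sub>R ?g' (f x) b)) (at x)"
    if "x \<in> S" for x
  proof -
    have g': "(g has_derivative ?g' (f x)) (at (f x))"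
      using Ck_on_SucD(1)[OF Suc.prems(2)] Suc.prems(3) that by auto
    have "?g' (f x) w = (\<Sum>b\<in>Basis. (w \<bullet> b) *\<^sub>R ?g' (f x) b)" for w
    proof -
      have "linear (?g' (f x))" using g' by (rule has_derivative_linear)
      then have "?g' (f x) (\<Sum>b\<in>Basis. (w \<bullet> b) *\<^sub>R b) = (\<Sum>b\<in>Basis. (w \<bullet> b) *\<^sub>R ?g' (f x) b)"
        by (simp add: linear_sum linear_scale)
      then show ?thesis by (simp add: euclidean_representation)
    qed
    then have eq: "?g' (f x) = (\<lambda>w. \<Sum>b\<in>Basis. (w \<bullet> b) *\<^sub>R ?g' (f x) b)"
      by (rule ext)
    have "((\<lambda>x. g (f x)) has_derivative (\<lambda>v. ?g' (f x) (?f' x v))) (at x)"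
      by (rule has_derivative_compose[OF Ck_on_SucD(1)[OF Suc.prems(1) that] g'])
    then show ?thesis
      by (subst (asm) eq)
  qed
  show ?case
  proof (rule Ck_on_SucI[OF assms der])
    show "Ck_on n S (\<lambda>x. \<Sum>b\<in>Basis. (?f' x v \<bullet> b) *\<^sub>R ?g' (f x) b)" for v
    proof (intro Ck_on_sum[OF assms] Ck_on_bilinear[OF assms bounded_bilinear_scaleR])
      show "Ck_on n S (\<lambda>x. ?f' x v \<bullet> b)" for b
        by (rule Ck_on_bounded_linear[OF assms bounded_linear_inner_left Ck_on_SucD(2)[OF Suc.prems(1)]])
      show "Ck_on n S (\<lambda>x. ?g' (f x) b)" for b
        by (rule Suc.IH[OF Ck_on_Suc_imp[OF Suc.prems(1)] Ck_on_SucD(2)[OF Suc.prems(2)] Suc.prems(3)])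
    qed
  qed
qed

text \<open>Gluing principle for zero extensions: S and the complement of the support are open and
  cover the space.\<close>

lemma Ck_on_Un:
  assumes "open S" "open T"
  shows "Ck_on n S f \<Longrightarrow> Ck_on n T f \<Longrightarrow> Ck_on n (S \<union> T) f"
  by (induction n arbitrary: f) (simp_all add: continuous_on_open_Un assms ball_Un)

lemma Ck_on_ident:
  assumes "open S" shows "Ck_on n S (\<lambda>x. x)"
proof (cases n)
  case (Suc m)
  show ?thesis
    unfolding Suc by (rule Ck_on_SucI[OF assms has_derivative_ident Ck_on_const])
qed simp

section \<open>Closure properties of smooth functions\<close>

lemma smooth_on_cong:
  "open S \<Longrightarrow> (\<And>x. x \<in> S \<Longrightarrow> f x = g x) \<Longrightarrow> smooth_on S f \<longleftrightarrow> smooth_on S g"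
  unfolding smooth_on_def by (metis Ck_on_cong)

lemma smooth_on_subset: "smooth_on S f \<Longrightarrow> T \<subseteq> S \<Longrightarrow> smooth_on T f"
  unfolding smooth_on_def using Ck_on_subset by blast

lemma smooth_on_const: "smooth_on S (\<lambda>x. c)"
  unfolding smooth_on_def using Ck_on_const by blast

lemma smooth_on_ident: "open S \<Longrightarrow> smooth_on S (\<lambda>x. x)"
  unfolding smooth_on_def using Ck_on_ident by blast

lemma smooth_on_add:
  "open S \<Longrightarrow> smooth_on S f \<Longrightarrow> smooth_on S g \<Longrightarrow> smooth_on S (\<lambda>x. f x + g x)"
  unfolding smooth_on_def using Ck_on_add by blast

lemma smooth_on_sum:
  "open S \<Longrightarrow> (\<And>i. i \<in> I \<Longrightarrow> smooth_on S (f i)) \<Longrightarrow> smooth_on S (\<lambda>x. \<Sum>i\<in>I. f i x)"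
  unfolding smooth_on_def by (simp add: Ck_on_sum)

lemma smooth_on_bounded_linear:
  "open S \<Longrightarrow> bounded_linear h \<Longrightarrow> smooth_on S f \<Longrightarrow> smooth_on S (\<lambda>x. h (f x))"
  unfolding smooth_on_def using Ck_on_bounded_linear by blast

lemma smooth_on_bilinear:
  "open S \<Longrightarrow> bounded_bilinear h \<Longrightarrow> smooth_on S f \<Longrightarrow> smooth_on S g \<Longrightarrow>
   smooth_on S (\<lambda>x. h (f x) (g x))"
  unfolding smooth_on_def using Ck_on_bilinear by blast

lemmas smooth_on_scaleR = smooth_on_bilinear[OF _ bounded_bilinear_scaleR]
lemmas smooth_on_inner = smooth_on_bilinear[OF _ bounded_bilinear_inner]

lemma smooth_on_mult:
  fixes f g :: "'a::real_normed_vector \<Rightarrow> real"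
  shows "open S \<Longrightarrow> smooth_on S f \<Longrightarrow> smooth_on S g \<Longrightarrow> smooth_on S (\<lambda>x. f x * g x)"
  by (rule smooth_on_bilinear[OF _ bounded_bilinear_mult])

lemma smooth_on_minus: "open S \<Longrightarrow> smooth_on S f \<Longrightarrow> smooth_on S (\<lambda>x. - f x)"
  by (rule smooth_on_bounded_linear[OF _ bounded_linear_minus[OF bounded_linear_ident]])

lemma smooth_on_diff:
  "open S \<Longrightarrow> smooth_on S f \<Longrightarrow> smooth_on S g \<Longrightarrow> smooth_on S (\<lambda>x. f x - g x)"
  using smooth_on_add[OF _ _ smooth_on_minus, of S f g] by simp

lemma smooth_on_prod:
  fixes f :: "'i \<Rightarrow> 'a::real_normed_vector \<Rightarrow> real"
  assumes "open S" "\<And>i. i \<in> I \<Longrightarrow> smooth_on S (f i)"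
  shows "smooth_on S (\<lambda>x. \<Prod>i\<in>I. f i x)"
  using assms(2)
  by (induction I rule: infinite_finite_induct)
    (auto intro: smooth_on_const smooth_on_mult[OF assms(1)])

lemma smooth_on_compose:
  fixes f :: "'a::real_normed_vector \<Rightarrow> 'b::euclidean_space" and g :: "'b \<Rightarrow> 'c::real_normed_vector"
  shows "open S \<Longrightarrow> smooth_on S f \<Longrightarrow> smooth_on T g \<Longrightarrow> f ` S \<subseteq> T \<Longrightarrow> smooth_on S (\<lambda>x. g (f x))"
  unfolding smooth_on_def using Ck_on_compose by blast

lemma smooth_on_Un:
  "open S \<Longrightarrow> open T \<Longrightarrow> smooth_on S f \<Longrightarrow> smooth_on T f \<Longrightarrow> smooth_on (S \<union> T) f"
  unfolding smooth_on_def using Ck_on_Un by blast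

lemma smooth_on_frechet:
  "smooth_on S f \<Longrightarrow> smooth_on S (\<lambda>x. frechet_derivative f (at x) v)"
  unfolding smooth_on_def using Ck_on_SucD(2) by blast

lemma smooth_on_has_derivative:
  "smooth_on S f \<Longrightarrow> x \<in> S \<Longrightarrow> (f has_derivative frechet_derivative f (at x)) (at x)"
  unfolding smooth_on_def using Ck_on_SucD(1) by blast

lemma smooth_on_continuous: "smooth_on S f \<Longrightarrow> continuous_on S f"
  unfolding smooth_on_def by (metis Ck_on.simps(1))

lemma smooth_on_componentwise:
  fixes f :: "'a::real_normed_vector \<Rightarrow> real^'n"
  assumes "open S" "\<And>i. smooth_on S (\<lambda>x. f x $ i)"
  shows "smooth_on S f"
proof -
  have "smooth_on S (\<lambda>x. \<Sum>i\<in>UNIV. f x $ i *\<^sub>R axis i (1::real))"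
    by (intro smooth_on_sum smooth_on_scaleR smooth_on_const assms)
  moreover have "f = (\<lambda>x. \<Sum>i\<in>UNIV. f x $ i *\<^sub>R axis i (1::real))"
    by (simp add: fun_eq_iff vec_eq_iff axis_def if_distrib cong: if_cong)
  ultimately show ?thesis by metis
qed

lemma smooth_on_nth:
  fixes f :: "'a::real_normed_vector \<Rightarrow> real^'n"
  shows "open S \<Longrightarrow> smooth_on S f \<Longrightarrow> smooth_on S (\<lambda>x. f x $ i)"
  by (rule smooth_on_bounded_linear[OF _ bounded_linear_vec_nth])

subsection \<open>Symmetry of second derivatives\<close>

text \<open>The mean value theorem is applied twice: along u to a difference taken in the direction
  v, and then along v to the resulting derivative. The second difference is symmetric in u and v,
  while the mixed derivative that represents it is not visibly so.\<close>

lemma second_difference: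
  fixes f :: "'a::real_normed_vector \<Rightarrow> real"
  assumes f: "Ck_on 2 (ball x r) f" and s: "s > 0" "s * (norm u + norm v) < r"
  obtains y where "dist y x \<le> s * (norm u + norm v)"
    "f (x + s *\<^sub>R u + s *\<^sub>R v) - f (x + s *\<^sub>R u) - f (x + s *\<^sub>R v) + f x =
      s * s * frechet_derivative (\<lambda>z. frechet_derivative f (at z) u) (at y) v"
proof -
  let ?D = "\<lambda>z. frechet_derivative f (at z)"
  let ?DD = "\<lambda>z. frechet_derivative (\<lambda>z. frechet_derivative f (at z) u) (at z)"
  have Suc2: "2 = Suc (Suc 0)" by simp
  have d1: "(f has_derivative ?D z) (at z)" if "z \<in> ball x r" for z
    using Ck_on_SucD(1)[OF f[unfolded Suc2] that] .
  have d2: "((\<lambda>z. ?D z u) has_derivative ?DD z) (at z)" if "z \<in> ball x r" for z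
    using Ck_on_SucD(1)[OF Ck_on_SucD(2)[OF f[unfolded Suc2]] that] .
  have inb: "norm (a *\<^sub>R u + b *\<^sub>R v) \<le> s * (norm u + norm v)"
    if "0 \<le> a" "a \<le> s" "0 \<le> b" "b \<le> s" for a b
  proof -
    have "norm (a *\<^sub>R u + b *\<^sub>R v) \<le> a * norm u + b * norm v"
      using norm_triangle_ineq[of "a *\<^sub>R u" "b *\<^sub>R v"] that by simp
    also have "\<dots> \<le> s * norm u + s * norm v"
      using that by (intro add_mono mult_right_mono) auto
    finally show ?thesis by (simp add: algebra_simps)
  qed
  have inball: "x + a *\<^sub>R u + b *\<^sub>R v \<in> ball x r" if "0 \<le> a" "a \<le> s" "0 \<le> b" "b \<le> s" for a b
  proof -
    have "dist x (x + (a *\<^sub>R u + b *\<^sub>R v)) = norm (a *\<^sub>R u + b *\<^sub>R v)"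
      by (metis add_diff_cancel_left' dist_commute dist_norm)
    then show ?thesis using inb[OF that] s by (simp add: add.assoc)
  qed
  \<comment> \<open>The summand \<open>0 *\<^sub>R v\<close> makes both terms members of one family
    with offset b in [0, s], so that \<open>inball\<close> and the derivative computation cover them
    together.\<close>
  define g where "g t = f (x + t *\<^sub>R u + s *\<^sub>R v) - f (x + t *\<^sub>R u + 0 *\<^sub>R v)" for t :: real
  have gd: "(g has_real_derivative (?D (x + t *\<^sub>R u + s *\<^sub>R v) u - ?D (x + t *\<^sub>R u + 0 *\<^sub>R v) u)) (at t)"
    if "0 \<le> t" "t \<le> s" for t
  proof -
    have 1: "((\<lambda>t. f (x + t *\<^sub>R u + b *\<^sub>R v)) has_derivative (\<lambda>h. ?D (x + t *\<^sub>R u + b *\<^sub>R v) (h *\<^sub>R u))) (at t)"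
      if "0 \<le> b" "b \<le> s" for b
      by (rule has_derivative_compose[of "\<lambda>t. x + t *\<^sub>R u + b *\<^sub>R v" "\<lambda>h. h *\<^sub>R u", OF _ d1[OF inball[OF \<open>0 \<le> t\<close> \<open>t \<le> s\<close> that]]])
        (auto intro!: derivative_eq_intros)
    have lin: "?D (x + t *\<^sub>R u + b *\<^sub>R v) (h *\<^sub>R u) = h * ?D (x + t *\<^sub>R u + b *\<^sub>R v) u"
      if "0 \<le> b" "b \<le> s" for b h
      using linear_scale[OF has_derivative_linear[OF d1[OF inball]]] that \<open>0 \<le> t\<close> \<open>t \<le> s\<close> by simp
    have "(g has_derivative (\<lambda>h. h * ?D (x + t *\<^sub>R u + s *\<^sub>R v) u - h * ?D (x + t *\<^sub>R u + 0 *\<^sub>R v) u)) (at t)"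
      unfolding g_def using has_derivative_diff[OF 1[of s] 1[of 0]] lin[of s] lin[of 0] s by simp
    then show ?thesis
      by (rule has_derivative_imp_has_field_derivative) (simp add: algebra_simps)
  qed
  obtain \<xi> where \<xi>: "0 < \<xi>" "\<xi> < s"
    "g s - g 0 = (s - 0) * (?D (x + \<xi> *\<^sub>R u + s *\<^sub>R v) u - ?D (x + \<xi> *\<^sub>R u + 0 *\<^sub>R v) u)"
    using MVT2[OF s(1) gd] by auto
  define h where "h t = ?D (x + \<xi> *\<^sub>R u + t *\<^sub>R v) u" for t
  have hd: "(h has_real_derivative ?DD (x + \<xi> *\<^sub>R u + t *\<^sub>R v) v) (at t)" if "0 \<le> t" "t \<le> s" for t
  proof -
    have b: "x + \<xi> *\<^sub>R u + t *\<^sub>R v \<in> ball x r" using inball[of \<xi> t] \<xi> that by simp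
    have 1: "(h has_derivative (\<lambda>k. ?DD (x + \<xi> *\<^sub>R u + t *\<^sub>R v) (k *\<^sub>R v))) (at t)"
      unfolding h_def
      by (rule has_derivative_compose[of "\<lambda>t. x + \<xi> *\<^sub>R u + t *\<^sub>R v" "\<lambda>h. h *\<^sub>R v", OF _ d2[OF b]]) (auto intro!: derivative_eq_intros)
    then show ?thesis
      by (rule has_derivative_imp_has_field_derivative)
        (simp only: linear_scale[OF has_derivative_linear[OF d2[OF b]]] real_scaleR_def mult.commute)
  qed
  obtain \<eta> where \<eta>: "0 < \<eta>" "\<eta> < s" "h s - h 0 = (s - 0) * ?DD (x + \<xi> *\<^sub>R u + \<eta> *\<^sub>R v) v"
    using MVT2[OF s(1) hd] by auto
  show thesis
  proof
    show "dist (x + \<xi> *\<^sub>R u + \<eta> *\<^sub>R v) x \<le> s * (norm u + norm v)"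
      using inb[of \<xi> \<eta>] \<xi> \<eta> by (simp add: dist_norm add.assoc)
    show "f (x + s *\<^sub>R u + s *\<^sub>R v) - f (x + s *\<^sub>R u) - f (x + s *\<^sub>R v) + f x =
      s * s * ?DD (x + \<xi> *\<^sub>R u + \<eta> *\<^sub>R v) v"
      using \<xi>(3) \<eta>(3) unfolding g_def h_def by (simp add: algebra_simps)
  qed
qed

text \<open>One and the same second difference is represented by both mixed derivatives, each at its
  own point near x. As the step size tends to 0 these points tend to x, and continuity of the second
  derivatives identifies the limits.\<close>

lemma symmetric_second_frechet_real:
  fixes f :: "'a::real_normed_vector \<Rightarrow> real"
  assumes "open S" "x \<in> S" "Ck_on 2 S f"
  shows "frechet_derivative (\<lambda>z. frechet_derivative f (at z) u) (at x) v =
    frechet_derivative (\<lambda>z. frechet_derivative f (at z) v) (at x) u"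
proof -
  obtain r where r: "r > 0" "ball x r \<subseteq> S" using assms openE by blast
  define M where "M = norm u + norm v"
  have M: "M \<ge> 0" unfolding M_def by simp
  \<comment> \<open>Dividing by M + 1 instead of M keeps the quotient meaningful for u = v = 0, and
    M / (M + 1) < 1 keeps the parallelogram inside the ball.\<close>
  define s where "s n = r / ((M + 1) * (real n + 2))" for n
  have s: "s n > 0" for n unfolding s_def using r M by (simp add: add_nonneg_pos)
  have sM: "s n * M < r" for n
  proof -
    have "M < (M + 1) * (real n + 2)"
      by (rule less_le_trans[OF _ mult_left_mono[of 1 "real n + 2" "M + 1"]]) (use M in auto)
    then have "r * M < r * ((M + 1) * (real n + 2))"
      using r by (intro mult_strict_left_mono) auto
    then show ?thesis unfolding s_def using M by (simp add: divide_less_eq add_nonneg_pos)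
  qed
  have s0: "s \<longlonglongrightarrow> 0"
  proof -
    have "(\<lambda>n. r / (M + 1) * (1 / real (n + 2))) \<longlonglongrightarrow> r / (M + 1) * 0"
      by (intro tendsto_mult_left LIMSEQ_ignore_initial_segment[OF lim_1_over_n])
    then show ?thesis unfolding s_def by (simp add: add.commute)
  qed
  have f: "Ck_on 2 (ball x r) f" using Ck_on_subset[OF assms(3) r(2)] .
  let ?A = "\<lambda>u v y. frechet_derivative (\<lambda>z. frechet_derivative f (at z) u) (at y) v"
  have lim: "\<exists>y. (\<forall>n. s n * s n * ?A u v (y n) =
      f (x + s n *\<^sub>R u + s n *\<^sub>R v) - f (x + s n *\<^sub>R u) - f (x + s n *\<^sub>R v) + f x) \<and>
      (\<lambda>n. ?A u v (y n)) \<longlonglongrightarrow> ?A u v x" if uv: "norm u + norm v = M" for u v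
  proof -
    have "\<forall>n. \<exists>y. dist y x \<le> s n * M \<and>
      f (x + s n *\<^sub>R u + s n *\<^sub>R v) - f (x + s n *\<^sub>R u) - f (x + s n *\<^sub>R v) + f x = s n * s n * ?A u v y"
      using second_difference[OF f s, of _ u v, unfolded uv, OF sM] by metis
    then obtain y where y: "\<And>n. dist (y n) x \<le> s n * M"
      "\<And>n. f (x + s n *\<^sub>R u + s n *\<^sub>R v) - f (x + s n *\<^sub>R u) - f (x + s n *\<^sub>R v) + f x = s n * s n * ?A u v (y n)"
      by metis
    have "(\<lambda>n. dist (y n) x) \<longlonglongrightarrow> 0"
      by (rule tendsto_sandwich[of "\<lambda>_. 0" _ _ "\<lambda>n. s n * M"])
        (use y s0 in \<open>auto intro!: tendsto_eq_intros\<close>)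
    then have "y \<longlonglongrightarrow> x" using tendsto_dist_iff by blast
    moreover have "isCont (?A u v) x"
    proof -
      have "Ck_on 0 (ball x r) (?A u v)"
        using Ck_on_SucD(2)[OF Ck_on_SucD(2)[of "Suc 0"]] f by (simp add: numeral_2_eq_2)
      then show ?thesis using r(1) by (simp add: continuous_on_eq_continuous_at)
    qed
    ultimately have "(\<lambda>n. ?A u v (y n)) \<longlonglongrightarrow> ?A u v x"
      using isCont_tendsto_compose by blast
    then show ?thesis using y(2) by metis
  qed
  obtain y where y: "\<And>n. s n * s n * ?A u v (y n) =
      f (x + s n *\<^sub>R u + s n *\<^sub>R v) - f (x + s n *\<^sub>R u) - f (x + s n *\<^sub>R v) + f x"
      "(\<lambda>n. ?A u v (y n)) \<longlonglongrightarrow> ?A u v x"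
    using lim[of u v] M_def by blast
  obtain z where z: "\<And>n. s n * s n * ?A v u (z n) =
      f (x + s n *\<^sub>R v + s n *\<^sub>R u) - f (x + s n *\<^sub>R v) - f (x + s n *\<^sub>R u) + f x"
      "(\<lambda>n. ?A v u (z n)) \<longlonglongrightarrow> ?A v u x"
    using lim[of v u] M_def by (metis add.commute)
  have "s n * s n * ?A u v (y n) = s n * s n * ?A v u (z n)" for n
    unfolding y(1) z(1) by (simp add: algebra_simps)
  then have "?A u v (y n) = ?A v u (z n)" for n
    using s[of n] by (metis less_irrefl mult_cancel_left mult_eq_0_iff)
  then show ?thesis using y(2) z(2) LIMSEQ_unique by simp
qed

lemma ext0_apply: "ext0 S f x = (if x \<in> S then f x else 0)"
  by (simp add: ext0_def)

section \<open>Gradient, curl and divergence of smooth fields\<close>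

lemma jacobian_nth: "jacobian f (at x) $ i $ j = frechet_derivative f (at x) (axis j 1) $ i"
  by (simp add: jacobian_def matrix_def)

lemma frechet_derivative_nth:
  fixes f :: "'a::real_normed_vector \<Rightarrow> real^'n"
  assumes "f differentiable (at x)"
  shows "frechet_derivative (\<lambda>x. f x $ i) (at x) v = frechet_derivative f (at x) v $ i"
proof -
  have "((\<lambda>x. f x $ i) has_derivative (\<lambda>v. frechet_derivative f (at x) v $ i)) (at x)"
    using assms
    by (intro bounded_linear.has_derivative[OF bounded_linear_vec_nth]) (simp add: frechet_derivative_works)
  from frechet_derivative_at[OF this] show ?thesis by (simp add: fun_eq_iff)
qed

lemma has_derivative_nthI:
  fixes f :: "'a::real_normed_vector \<Rightarrow> real^'n"
  assumes "\<And>i. ((\<lambda>x. f x $ i) has_derivative D i) (at x)"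
  shows "(f has_derivative (\<lambda>h. \<chi> i. D i h)) (at x)"
  using assms by (subst has_derivative_componentwise_within) (auto simp: Basis_vec_def inner_axis)

lemma jacobian_eqI:
  fixes f :: "real^'m \<Rightarrow> real^'n"
  assumes "\<And>i. ((\<lambda>x. f x $ i) has_derivative D i) (at x)"
  shows "jacobian f (at x) $ i $ j = D i (axis j 1)"
  unfolding jacobian_nth frechet_derivative_at[OF has_derivative_nthI[OF assms], symmetric] by simp

lemma linear_expand_axis:
  fixes L :: "real^'n \<Rightarrow> 'b::real_vector"
  assumes "linear L"
  shows "L v = (\<Sum>l\<in>UNIV. v $ l *\<^sub>R L (axis l 1))"
proof -
  have "L (\<Sum>l\<in>UNIV. v $ l *\<^sub>R axis l 1) = (\<Sum>l\<in>UNIV. v $ l *\<^sub>R L (axis l 1))"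
    using assms by (simp add: linear_sum linear_scale)
  moreover have "(\<Sum>l\<in>UNIV. v $ l *\<^sub>R axis l 1) = v"
    using basis_expansion[of v] by (simp add: scalar_mult_eq_scaleR)
  ultimately show ?thesis by simp
qed

text \<open>The chain rule in coordinates: the pull-back formulas are verified by comparing products
  of partial derivatives.\<close>

lemma frechet_derivative_compose_axis:
  fixes \<theta> :: "real^'m \<Rightarrow> real^'n" and V :: "real^'n \<Rightarrow> 'b::real_normed_vector"
  assumes "\<theta> differentiable (at x)" "V differentiable (at (\<theta> x))"
  shows "((\<lambda>x. V (\<theta> x)) has_derivative
     (\<lambda>h. \<Sum>l\<in>UNIV. (frechet_derivative \<theta> (at x) h $ l) *\<^sub>R frechet_derivative V (at (\<theta> x)) (axis l 1))) (at x)"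
proof -
  have "(V has_derivative frechet_derivative V (at (\<theta> x))) (at (\<theta> x))"
    using assms by (simp add: frechet_derivative_works)
  from has_derivative_compose[of \<theta> _ x UNIV, OF _ this] assms(1)
  have "((\<lambda>x. V (\<theta> x)) has_derivative (\<lambda>h. frechet_derivative V (at (\<theta> x)) (frechet_derivative \<theta> (at x) h))) (at x)"
    by (simp add: frechet_derivative_works)
  then show ?thesis
    by (subst (asm) linear_expand_axis[OF linear_frechet_derivative[OF assms(2)]])
qed

lemma smooth_on_differentiable: "smooth_on S f \<Longrightarrow> x \<in> S \<Longrightarrow> f differentiable (at x)"
  using smooth_on_has_derivative differentiableI by blast

lemma symmetric_second_frechet:
  fixes f :: "'a::real_normed_vector \<Rightarrow> real^'n"
  assumes "open S" "x \<in> S" "smooth_on S f"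
  shows "frechet_derivative (\<lambda>z. frechet_derivative f (at z) u $ i) (at x) v =
    frechet_derivative (\<lambda>z. frechet_derivative f (at z) v $ i) (at x) u"
proof -
  have sm: "smooth_on S (\<lambda>x. f x $ i)" by (rule smooth_on_nth[OF assms(1,3)])
  have eq: "frechet_derivative (\<lambda>z. frechet_derivative f (at z) w $ i) (at x) =
      frechet_derivative (\<lambda>z. frechet_derivative (\<lambda>z. f z $ i) (at z) w) (at x)" for w
    by (rule frechet_derivative_transform_within_open[OF _ assms(1,2)])
      (use assms smooth_on_differentiable[OF assms(3)]
          smooth_on_differentiable[OF smooth_on_nth[OF assms(1) smooth_on_frechet[OF assms(3)]]] in
        \<open>auto simp: frechet_derivative_nth\<close>)
  show ?thesis
    unfolding eq using symmetric_second_frechet_real[OF assms(1,2)] sm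
    by (simp add: smooth_on_def)
qed

lemma grad_nth: "grad f x $ i = frechet_derivative f (at x) (axis i 1)"
  by (simp add: grad_def)

lemma curl_nth:
  "curl g x $ 1 = frechet_derivative g (at x) (axis 2 1) $ 3 - frechet_derivative g (at x) (axis 3 1) $ 2"
  "curl g x $ 2 = frechet_derivative g (at x) (axis 3 1) $ 1 - frechet_derivative g (at x) (axis 1 1) $ 3"
  "curl g x $ 3 = frechet_derivative g (at x) (axis 1 1) $ 2 - frechet_derivative g (at x) (axis 2 1) $ 1"
  by (simp_all add: curl_def jacobian_nth)

lemma divergence_eq: "divergence g x =
    frechet_derivative g (at x) (axis 1 1) $ 1 + frechet_derivative g (at x) (axis 2 1) $ 2
    + frechet_derivative g (at x) (axis 3 1) $ 3"
  by (simp add: divergence_def jacobian_nth sum_3)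

lemma smooth_on_grad: "open S \<Longrightarrow> smooth_on S f \<Longrightarrow> smooth_on S (grad f)"
  by (rule smooth_on_componentwise) (simp_all add: grad_nth smooth_on_frechet)

lemma smooth_on_curl:
  assumes "open S" "smooth_on S g" shows "smooth_on S (curl g)"
proof (rule smooth_on_componentwise[OF assms(1)])
  have "\<forall>i. smooth_on S (\<lambda>x. curl g x $ i)"
    unfolding forall_3 curl_nth
    by (intro conjI smooth_on_diff smooth_on_nth smooth_on_frechet assms)
  then show "smooth_on S (\<lambda>x. curl g x $ i)" for i by blast
qed

lemma smooth_on_divergence:
  assumes "open S" "smooth_on S g" shows "smooth_on S (divergence g)"
  unfolding divergence_eq[abs_def]
  by (intro smooth_on_add smooth_on_nth smooth_on_frechet assms)

lemma frechet_derivative_eq_0: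
  assumes "\<forall>\<^sub>F y in nhds x. f y = 0"
  shows "frechet_derivative f (at x) = (\<lambda>v. 0)"
proof -
  obtain U where U: "open U" "x \<in> U" "\<And>y. y \<in> U \<Longrightarrow> f y = 0"
    using assms unfolding eventually_nhds by blast
  have "(f has_derivative (\<lambda>v. 0)) (at x)"
    by (rule has_derivative_transform_within_open[OF has_derivative_const[of 0] U(1,2)])
      (use U(3) in simp)
  then show ?thesis using frechet_derivative_at by metis
qed

section \<open>Test functions and their zero extensions\<close>

lemma C0_inftyD: "f \<in> C0_infty S \<Longrightarrow> smooth_on S f"
  by (simp add: C0_infty_def)

text \<open>Off the compact support the test function vanishes in a whole neighbourhood of each
  point, which is all that a differential operator sees. The same compact set therefore serves for
  g.\<close>

lemma C0_infty_local:
  assumes "open S" "\<phi> \<in> C0_infty S" "smooth_on S g"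
    "\<And>x. x \<in> S \<Longrightarrow> \<forall>\<^sub>F y in nhds x. \<phi> y = 0 \<Longrightarrow> g x = 0"
  shows "g \<in> C0_infty S"
proof -
  obtain C where C: "compact C" "C \<subseteq> S" "\<And>x. x \<in> S - C \<Longrightarrow> \<phi> x = 0"
    using assms(2) unfolding C0_infty_def by blast
  have "g x = 0" if "x \<in> S - C" for x
  proof (rule assms(4))
    show "\<forall>\<^sub>F y in nhds x. \<phi> y = 0"
      unfolding eventually_nhds
      using C(3) that open_Diff[OF assms(1) compact_imp_closed[OF C(1)]] by blast
  qed (use that in blast)
  then show ?thesis unfolding C0_infty_def using C assms(3) by blast
qed

lemma C0_infty_frechet:
  assumes "open S" "f \<in> C0_infty S" shows "(\<lambda>x. frechet_derivative f (at x) v) \<in> C0_infty S"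
proof (rule C0_infty_local[OF assms])
  show "smooth_on S (\<lambda>x. frechet_derivative f (at x) v)" using assms by (intro smooth_on_frechet C0_inftyD)
  show "frechet_derivative f (at x) v = 0" if "\<forall>\<^sub>F y in nhds x. f y = 0" for x
    by (simp add: frechet_derivative_eq_0[OF that])
qed

lemma C0_infty_grad:
  assumes "open S" "f \<in> C0_infty S" shows "grad f \<in> C0_infty S"
proof (rule C0_infty_local[OF assms])
  show "smooth_on S (grad f)" using assms by (intro smooth_on_grad C0_inftyD)
  show "grad f x = 0" if "\<forall>\<^sub>F y in nhds x. f y = 0" for x
    by (simp add: vec_eq_iff grad_nth frechet_derivative_eq_0[OF that])
qed

lemma C0_infty_curl:
  assumes "open S" "f \<in> C0_infty S" shows "curl f \<in> C0_infty S"
proof (rule C0_infty_local[OF assms])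
  show "smooth_on S (curl f)" using assms by (intro smooth_on_curl C0_inftyD)
  show "curl f x = 0" if "\<forall>\<^sub>F y in nhds x. f y = 0" for x
    by (simp add: vec_eq_iff forall_3 curl_nth frechet_derivative_eq_0[OF that])
qed

lemma C0_infty_divergence:
  assumes "open S" "f \<in> C0_infty S" shows "divergence f \<in> C0_infty S"
proof (rule C0_infty_local[OF assms])
  show "smooth_on S (divergence f)" using assms by (intro smooth_on_divergence C0_inftyD)
  show "divergence f x = 0" if "\<forall>\<^sub>F y in nhds x. f y = 0" for x
    by (simp add: divergence_eq frechet_derivative_eq_0[OF that])
qed

lemma C0_infty_bounded_linear:
  assumes "open S" "bounded_linear h" "f \<in> C0_infty S" shows "(\<lambda>x. h (f x)) \<in> C0_infty S"
proof (rule C0_infty_local[OF assms(1,3)])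
  show "smooth_on S (\<lambda>x. h (f x))"
    by (rule smooth_on_bounded_linear[OF assms(1,2) C0_inftyD[OF assms(3)]])
  show "h (f x) = 0" if "\<forall>\<^sub>F y in nhds x. f y = 0" for x
    using eventually_nhds_x_imp_x[OF that] linear_0[OF bounded_linear.linear[OF assms(2)]] by simp
qed

lemma C0_infty_nth:
  fixes f :: "'a::real_normed_vector \<Rightarrow> real^'n"
  shows "open S \<Longrightarrow> f \<in> C0_infty S \<Longrightarrow> (\<lambda>x. f x $ i) \<in> C0_infty S"
  by (rule C0_infty_bounded_linear[OF _ bounded_linear_vec_nth])

lemma C0_infty_scaleR:
  fixes f :: "'a::real_normed_vector \<Rightarrow> real"
  shows "open S \<Longrightarrow> f \<in> C0_infty S \<Longrightarrow> (\<lambda>x. f x *\<^sub>R c) \<in> C0_infty S"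
  by (rule C0_infty_bounded_linear[OF _ bounded_linear_scaleR_left])

text \<open>Boundary points of S are included: the complement of the compact support is an open
  neighbourhood of x on which the extension is zero.\<close>

lemma C0_infty_eventually_0:
  assumes "\<phi> \<in> C0_infty S" "x \<notin> S"
  shows "\<forall>\<^sub>F y in nhds x. ext0 S \<phi> y = 0"
proof -
  obtain C where C: "compact C" "C \<subseteq> S" "\<And>x. x \<in> S - C \<Longrightarrow> \<phi> x = 0"
    using assms(1) unfolding C0_infty_def by blast
  show ?thesis
    unfolding eventually_nhds
    by (rule exI[of _ "- C"]) (use C assms(2) compact_imp_closed in \<open>auto simp: ext0_def\<close>)
qed

lemma frechet_derivative_ext0:
  assumes "open S" "\<phi> \<in> C0_infty S"
  shows "frechet_derivative (ext0 S \<phi>) (at x) = (if x \<in> S then frechet_derivative \<phi> (at x) else (\<lambda>_. 0))"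
proof (cases "x \<in> S")
  case True
  have "frechet_derivative \<phi> (at x) = frechet_derivative (ext0 S \<phi>) (at x)"
    by (rule frechet_derivative_transform_within_open[OF _ assms(1) True])
      (use smooth_on_differentiable[OF C0_inftyD[OF assms(2)] True] in \<open>auto simp: ext0_apply\<close>)
  then show ?thesis using True by simp
next
  case False
  then show ?thesis using frechet_derivative_eq_0[OF C0_infty_eventually_0[OF assms(2) False]] by simp
qed

text \<open>The extension agrees with \<phi> on S and with 0 off the compact support; these two open
  sets cover the space, so smoothness can be glued.\<close>

lemma C0_infty_ext0:
  assumes "open S" "\<phi> \<in> C0_infty S"
  shows "ext0 S \<phi> \<in> C0_infty UNIV"
proof -
  obtain C where C: "compact C" "C \<subseteq> S" "\<And>x. x \<in> S - C \<Longrightarrow> \<phi> x = 0"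
    using assms(2) unfolding C0_infty_def by blast
  have "smooth_on S (ext0 S \<phi>)"
    using C0_inftyD[OF assms(2)] smooth_on_cong[OF assms(1), of "ext0 S \<phi>" \<phi>] by (simp add: ext0_apply)
  moreover have "smooth_on (- C) (ext0 S \<phi>)"
  proof (subst smooth_on_cong)
    show "open (- C)" using compact_imp_closed[OF C(1)] by (rule open_Compl)
    show "ext0 S \<phi> x = 0" if "x \<in> - C" for x
      using that C(3) by (simp add: ext0_apply)
  qed (rule smooth_on_const)
  ultimately have "smooth_on (S \<union> - C) (ext0 S \<phi>)"
    using assms(1) compact_imp_closed[OF C(1)] by (intro smooth_on_Un) auto
  moreover have "S \<union> - C = UNIV" using C(2) by auto
  ultimately show ?thesis
    unfolding C0_infty_def using C by (auto simp: ext0_apply intro!: exI[of _ C])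
qed

lemma grad_ext0: "open S \<Longrightarrow> \<phi> \<in> C0_infty S \<Longrightarrow> grad (ext0 S \<phi>) x = ext0 S (grad \<phi>) x"
  by (simp add: vec_eq_iff grad_nth frechet_derivative_ext0 ext0_apply)

lemma curl_ext0: "open S \<Longrightarrow> \<phi> \<in> C0_infty S \<Longrightarrow> curl (ext0 S \<phi>) x = ext0 S (curl \<phi>) x"
  by (simp add: vec_eq_iff forall_3 curl_nth frechet_derivative_ext0 ext0_apply)

lemma curl_grad:
  assumes "open S" "x \<in> S" "smooth_on S u"
  shows "curl (grad u) x = 0"
proof -
  have "frechet_derivative (grad u) (at x) (axis j 1) $ i =
      frechet_derivative (\<lambda>z. frechet_derivative u (at z) (axis i 1)) (at x) (axis j 1)" for i j
    using smooth_on_differentiable[OF smooth_on_grad[OF assms(1,3)] assms(2)]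
      frechet_derivative_nth[of "grad u" x i "axis j 1"] by (simp add: grad_nth)
  moreover have "Ck_on 2 S u" using assms(3) by (simp add: smooth_on_def)
  ultimately show ?thesis
    unfolding vec_eq_iff forall_3 curl_nth
    using symmetric_second_frechet_real[OF assms(1,2), of u] by simp
qed

lemma div_curl:
  assumes "open S" "x \<in> S" "smooth_on S g"
  shows "divergence (curl g) x = 0"
proof -
  let ?g = "\<lambda>j i z. frechet_derivative g (at z) (axis j 1) $ i"
  have d: "(?g j i has_derivative frechet_derivative (?g j i) (at x)) (at x)" for i j
    using smooth_on_has_derivative[OF smooth_on_nth[OF assms(1) smooth_on_frechet[OF assms(3)]] assms(2)] .
  have "frechet_derivative (\<lambda>z. ?g j i z - ?g k l z) (at x) v =
      frechet_derivative (?g j i) (at x) v - frechet_derivative (?g k l) (at x) v" for i j k l v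
    by (simp add: frechet_derivative_at[OF has_derivative_diff[OF d[of j i] d[of k l]], symmetric])
  moreover have "frechet_derivative (curl g) (at x) v $ i = frechet_derivative (\<lambda>z. curl g z $ i) (at x) v" for v i
    by (rule frechet_derivative_nth[symmetric])
      (rule smooth_on_differentiable[OF smooth_on_curl[OF assms(1,3)] assms(2)])
  ultimately show ?thesis
    unfolding divergence_eq using symmetric_second_frechet[OF assms]
    by (simp add: curl_nth)
qed

subsection \<open>Pull-backs\<close>

lemma grad_pullback:
  assumes "\<theta> differentiable (at x)" "F differentiable (at (\<theta> x))"
  shows "grad (\<lambda>x. F (\<theta> x)) x = transpose (jacobian \<theta> (at x)) *v grad F (\<theta> x)"
  unfolding vec_eq_iff grad_nth matrix_vector_mult_def transpose_def
  using frechet_derivative_at[OF frechet_derivative_compose_axis[OF assms], symmetric]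
  by (simp add: jacobian_nth grad_nth)

text \<open>The transposed cofactor matrix, written out so that its entries are visibly smooth.\<close>

definition adj3 :: "real^3^3 \<Rightarrow> real^3^3" where
  "adj3 A = vector [
     vector [A$2$2 * A$3$3 - A$2$3 * A$3$2, A$1$3 * A$3$2 - A$1$2 * A$3$3, A$1$2 * A$2$3 - A$1$3 * A$2$2],
     vector [A$2$3 * A$3$1 - A$2$1 * A$3$3, A$1$1 * A$3$3 - A$1$3 * A$3$1, A$1$3 * A$2$1 - A$1$1 * A$2$3],
     vector [A$2$1 * A$3$2 - A$2$2 * A$3$1, A$1$2 * A$3$1 - A$1$1 * A$3$2, A$1$1 * A$2$2 - A$1$2 * A$2$1]]"

lemma adj3_mult_vec: "A *v (adj3 A *v v) = det A *\<^sub>R v"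
  by (simp add: vec_eq_iff forall_3 adj3_def matrix_vector_mult_def sum_3 det_3 algebra_simps)

lemma matrix_inv_left:
  fixes A :: "'a::semiring_1^'n^'m"
  assumes "invertible A"
  shows "matrix_inv A ** A = mat 1"
  using someI_ex[OF assms[unfolded invertible_def]] by (simp add: matrix_inv_def)

text \<open>Applying the inverse to A (adj A) v = (det A) v. This rewrites the weight of
  \<open>Kd\<close> as a matrix whose entries are polynomials in the entries of A.\<close>

lemma det_matrix_inv_mult:
  fixes A :: "real^3^3"
  assumes "invertible A"
  shows "det A *\<^sub>R (matrix_inv A *v v) = adj3 A *v v"
proof -
  have "det A *\<^sub>R (matrix_inv A *v v) = matrix_inv A *v (A *v (adj3 A *v v))"
    by (simp add: adj3_mult_vec matrix_vector_mult_scaleR)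
  also have "\<dots> = adj3 A *v v"
    by (simp add: matrix_vector_mul_assoc matrix_mul_assoc matrix_inv_left[OF assms])
  finally show ?thesis .
qed

context
  fixes S :: "(real^3) set" and x :: "real^3" and \<theta> V :: "real^3 \<Rightarrow> real^3"
  assumes S: "open S" "x \<in> S" and \<theta>: "smooth_on S \<theta>" and V: "V differentiable (at (\<theta> x))"
begin

text \<open>In index notation \<open>J m i\<close> is the i-th partial derivative of the m-th
  component of \<theta> as a function of the point. \<open>H m i j\<close> is its j-th partial
  derivative at x, and \<open>W m l\<close> is the l-th partial derivative of the m-th component of
  V at \<theta> x. In these letters both pull-back formulas become polynomial identities modulo the
  symmetry of \<open>H\<close> in its last two indices.\<close>

private definition J :: "3 \<Rightarrow> 3 \<Rightarrow> real^3 \<Rightarrow> real" where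
  "J m i z = frechet_derivative \<theta> (at z) (axis i 1) $ m"

private definition H :: "3 \<Rightarrow> 3 \<Rightarrow> 3 \<Rightarrow> real" where
  "H m i j = frechet_derivative (J m i) (at x) (axis j 1)"

private lemma J_deriv: "(J m i has_derivative frechet_derivative (J m i) (at x)) (at x)"
  using smooth_on_has_derivative[OF smooth_on_nth[OF S(1) smooth_on_frechet[OF \<theta>]] S(2)]
  by (simp add: J_def[abs_def])

private lemma H_sym: "H m i j = H m j i"
  unfolding H_def J_def[abs_def] by (rule symmetric_second_frechet[OF S \<theta>])

private definition W :: "3 \<Rightarrow> 3 \<Rightarrow> real" where
  "W m l = frechet_derivative V (at (\<theta> x)) (axis l 1) $ m"

private lemma V_deriv:
  "((\<lambda>z. V (\<theta> z) $ m) has_derivative (\<lambda>h. \<Sum>l\<in>UNIV. frechet_derivative \<theta> (at x) h $ l * W m l)) (at x)"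
  using bounded_linear.has_derivative[OF bounded_linear_vec_nth
      frechet_derivative_compose_axis[OF smooth_on_differentiable[OF \<theta> S(2)] V], of m]
  by (simp add: W_def)

text \<open>In the curl the terms \<open>H m i j * V (\<theta> x) $ m\<close> are antisymmetrised in
  i and j, hence cancel. Antisymmetrising the products of two \<open>J\<close> factors produces the
  2 by 2 minors of the Jacobian, applied to the antisymmetric part of \<open>W\<close>.\<close>

lemma curl_pullback:
  "curl (\<lambda>z. transpose (jacobian \<theta> (at z)) *v V (\<theta> z)) x = adj3 (jacobian \<theta> (at x)) *v curl V (\<theta> x)"
proof -
  let ?h = "\<lambda>z. transpose (jacobian \<theta> (at z)) *v V (\<theta> z)"
  have "jacobian ?h (at x) $ i $ j = (\<Sum>m\<in>UNIV. J m i x * (\<Sum>l\<in>UNIV. J l j x * W m l) + H m i j * V (\<theta> x) $ m)" for i j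
  proof -
    have "((\<lambda>z. ?h z $ i) has_derivative (\<lambda>h. \<Sum>m\<in>UNIV. J m i x * (\<Sum>l\<in>UNIV. frechet_derivative \<theta> (at x) h $ l * W m l)
        + frechet_derivative (J m i) (at x) h * V (\<theta> x) $ m)) (at x)" for i
    proof -
      have "(\<lambda>z. ?h z $ i) = (\<lambda>z. \<Sum>m\<in>UNIV. J m i z * V (\<theta> z) $ m)"
        by (simp add: fun_eq_iff matrix_vector_mult_def transpose_def jacobian_nth J_def)
      then show ?thesis
        using has_derivative_sum[OF has_derivative_mult[OF J_deriv V_deriv]] by simp
    qed
    from jacobian_eqI[OF this] show ?thesis
      by (simp add: H_def J_def)
  qed
  then show ?thesis
    unfolding vec_eq_iff forall_3 curl_def Let_def
    by (simp add: adj3_def matrix_vector_mult_def sum_3 jacobian_nth J_def[symmetric] W_def[symmetric]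
        H_sym[of _ 2 1] H_sym[of _ 3 1] H_sym[of _ 3 2] algebra_simps)
qed

text \<open>The terms with second derivatives add up to zero by the Piola identity: the cofactor
  matrix is divergence free. The remaining terms contract the Jacobian with its adjugate, which
  gives the determinant times the trace of \<open>W\<close>.\<close>

lemma divergence_pullback:
  "divergence (\<lambda>z. adj3 (jacobian \<theta> (at z)) *v V (\<theta> z)) x = det (jacobian \<theta> (at x)) * divergence V (\<theta> x)"
proof -
  let ?h = "\<lambda>z. adj3 (jacobian \<theta> (at z)) *v V (\<theta> z)"
  let ?J' = "\<lambda>m i. frechet_derivative (J m i) (at x)"
  let ?V' = "\<lambda>m h. \<Sum>l\<in>UNIV. frechet_derivative \<theta> (at x) h $ l * W m l"
  \<comment> \<open>The 2 by 2 minor on the rows a, p and the columns b, q. The order of the indices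
    carries the sign of the cofactor.\<close>
  define c where "c a b p q z = J a b z * J p q z - J a q z * J p b z" for a b p q z
  define c' where "c' a b p q h = (J a b x * ?J' p q h + ?J' a b h * J p q x) - (J a q x * ?J' p b h + ?J' a q h * J p b x)" for a b p q h
  have c: "(c a b p q has_derivative c' a b p q) (at x)" for a b p q
    unfolding c_def[abs_def] c'_def[abs_def]
    by (intro has_derivative_diff has_derivative_mult J_deriv)
  define D where "D a b p q r s u v y w t o' = (\<lambda>h. (c a b p q x * ?V' 1 h + c' a b p q h * V (\<theta> x) $ 1)
     + (c r s u v x * ?V' 2 h + c' r s u v h * V (\<theta> x) $ 2)
     + (c y w t o' x * ?V' 3 h + c' y w t o' h * V (\<theta> x) $ 3))" for a b p q r s u v y w t o'
  have row: "((\<lambda>z. c a b p q z * V (\<theta> z) $ 1 + c r s u v z * V (\<theta> z) $ 2 + c y w t o' z * V (\<theta> z) $ 3)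
      has_derivative D a b p q r s u v y w t o') (at x)" for a b p q r s u v y w t o'
    unfolding D_def by (intro has_derivative_add has_derivative_mult c V_deriv)
  \<comment> \<open>The three index lists spell out the three rows of \<open>adj3\<close> as minors
    \<open>c\<close>.\<close>
  let ?D = "\<lambda>i::3. if i = 1 then D 2 2 3 3 1 3 3 2 1 2 2 3 else
     if i = 2 then D 2 3 3 1 1 1 3 3 1 3 2 1 else D 2 1 3 2 1 2 3 1 1 1 2 2"
  have "\<forall>i. ((\<lambda>z. ?h z $ i) has_derivative ?D i) (at x)"
    unfolding forall_3
    using row[of 2 2 3 3 1 3 3 2 1 2 2 3] row[of 2 3 3 1 1 1 3 3 1 3 2 1] row[of 2 1 3 2 1 2 3 1 1 1 2 2]
    by (simp add: adj3_def matrix_vector_mult_def sum_3 jacobian_nth c_def J_def)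
  then have "jacobian ?h (at x) $ i $ j = ?D i (axis j 1)" for i j
    using jacobian_eqI[of ?h ?D x i j] by blast
  then show ?thesis
    unfolding divergence_def
    by (simp add: D_def c_def c'_def sum_3 jacobian_nth det_3 J_def[symmetric] W_def[symmetric] H_def[symmetric]
        H_sym[of _ 2 1] H_sym[of _ 3 1] H_sym[of _ 3 2] algebra_simps)
qed

end

section \<open>Smooth bump functions\<close>

text \<open>The negative powers of t make the family closed under differentiation up to linear
  combinations, so smoothness of all members follows by one induction. The member m = 0 is the
  profile of the mollifier.\<close>

definition flat :: "nat \<Rightarrow> real \<Rightarrow> real" where
  "flat m t = (if t > 0 then exp (- (1 / t)) / t ^ m else 0)"

lemma flat_tendsto_0: "(flat m \<longlongrightarrow> 0) (at 0)"
proof (rule filterlim_split_at)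
  have "\<forall>\<^sub>F t in at_left (0::real). flat m t = 0"
    by (auto simp: eventually_at_filter flat_def)
  then show "(flat m \<longlongrightarrow> 0) (at_left 0)"
    using tendsto_eventually by blast
  have "((\<lambda>t::real. inverse t ^ m / exp (inverse t)) \<longlongrightarrow> 0) (at_right 0)"
    using filterlim_compose[OF tendsto_power_div_exp_0 filterlim_inverse_at_top_right] .
  moreover have "\<forall>\<^sub>F t in at_right (0::real). inverse t ^ m / exp (inverse t) = flat m t"
    by (auto simp: eventually_at_filter flat_def exp_minus field_simps)
  ultimately show "(flat m \<longlongrightarrow> 0) (at_right 0)"
    using Lim_transform_eventually by blast
qed

lemma flat_has_derivative:
  "(flat m has_derivative (\<lambda>v. v * (flat (m + 2) t - real m * flat (m + 1) t))) (at t)"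
proof -
  have "(flat m has_real_derivative (flat (m + 2) t - real m * flat (m + 1) t)) (at t)"
  proof (cases t "0::real" rule: linorder_cases)
    case less
    have "((\<lambda>t. 0) has_real_derivative (flat (m + 2) t - real m * flat (m + 1) t)) (at t)"
      using less by (simp add: flat_def)
    then show ?thesis
      by (rule has_field_derivative_transform_within_open[where S = "{..<0}"])
        (use less in \<open>auto simp: flat_def\<close>)
  next
    case equal
    \<comment> \<open>At the origin the difference quotient of \<open>flat m\<close> is
      \<open>flat (m + 1)\<close> itself, whose limit is already known to be 0.\<close>
    have "((\<lambda>h. (flat m (0 + h) - flat m 0) / h) \<longlongrightarrow> 0) (at 0)"
    proof (rule Lim_transform_eventually[OF flat_tendsto_0[of "m + 1"]])
      show "\<forall>\<^sub>F h in at 0. flat (m + 1) h = (flat m (0 + h) - flat m 0) / h"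
        by (auto simp: eventually_at_filter flat_def)
    qed
    then show ?thesis using equal by (simp add: DERIV_def flat_def)
  next
    case greater
    have "((\<lambda>t. exp (- (1 / t)) / t ^ m) has_real_derivative
        (exp (- (1 / t)) * (1 / t\<^sup>2) * t ^ m - exp (- (1 / t)) * (real m * t ^ (m - 1))) / (t ^ m * t ^ m)) (at t)"
      using greater by (auto intro!: derivative_eq_intros simp: power2_eq_square)
    also have "(exp (- (1 / t)) * (1 / t\<^sup>2) * t ^ m - exp (- (1 / t)) * (real m * t ^ (m - 1))) / (t ^ m * t ^ m) =
        flat (m + 2) t - real m * flat (m + 1) t"
      using greater by (cases m) (simp_all add: flat_def field_simps power2_eq_square)
    finally show ?thesis
      by (rule has_field_derivative_transform_within_open[where S = "{0<..}"])
        (use greater in \<open>auto simp: flat_def\<close>)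
  qed
  then show ?thesis
    by (rule has_derivative_eq_rhs[OF has_field_derivative_imp_has_derivative]) (simp add: fun_eq_iff)
qed

lemma smooth_on_flat: "smooth_on UNIV (flat m)"
proof -
  have "\<forall>m. Ck_on n UNIV (flat m)" for n
  proof (induction n)
    case 0
    show ?case
      using has_derivative_continuous[OF flat_has_derivative]
      by (simp add: continuous_at_imp_continuous_on)
  next
    case (Suc n)
    have "Ck_on n UNIV (\<lambda>t. v * (flat (m + 2) t - real m * flat (m + 1) t))" for v m
    proof -
      have "Ck_on n UNIV (\<lambda>t. v * flat (m + 2) t + (- v * real m) * flat (m + 1) t)"
        by (intro Ck_on_add Ck_on_bounded_linear[OF open_UNIV bounded_linear_mult_right])
          (use Suc in auto)
      then show ?thesis by (simp add: algebra_simps)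
    qed
    then show ?case
      using Ck_on_SucI[OF open_UNIV flat_has_derivative] by blast
  qed
  then show ?thesis by (simp add: smooth_on_def)
qed

text \<open>The squared norm as an inner product is polynomial in y, so no differentiation of the
  norm at the origin is involved.\<close>

lemma mollifier_eq: "mollifier \<eta> y = \<eta> * flat 0 (1 - y \<bullet> y)"
  by (simp add: mollifier_def flat_def power2_norm_eq_inner[symmetric] abs_square_less_1)

lemma smooth_on_mollifier: "smooth_on UNIV (mollifier \<eta>)"
proof -
  have "smooth_on UNIV (\<lambda>y::real^3. \<eta> * flat 0 (1 - y \<bullet> y))"
    by (rule smooth_on_mult[OF open_UNIV smooth_on_const])
      (intro smooth_on_compose[OF open_UNIV _ smooth_on_flat] smooth_on_diff smooth_on_const
        smooth_on_inner smooth_on_ident open_UNIV subset_UNIV)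
  then show ?thesis by (simp add: mollifier_eq[abs_def])
qed

lemma mollifier_C0_infty: "mollifier \<eta> \<in> C0_infty UNIV"
  unfolding C0_infty_def
  by (auto simp: smooth_on_mollifier mollifier_def intro!: exI[of _ "cball 0 1"])

lemma C0_infty_affine:
  fixes \<psi> :: "'a::euclidean_space \<Rightarrow> 'b::real_normed_vector"
  assumes "\<psi> \<in> C0_infty UNIV" "a \<noteq> 0"
  shows "(\<lambda>z. \<psi> (a *\<^sub>R (z - X))) \<in> C0_infty UNIV"
proof -
  obtain C where C: "compact C" "\<And>x. x \<notin> C \<Longrightarrow> \<psi> x = 0"
    using assms(1) unfolding C0_infty_def by auto
  have "smooth_on UNIV (\<lambda>z. \<psi> (a *\<^sub>R (z - X)))"
    by (intro smooth_on_compose[OF open_UNIV _ C0_inftyD[OF assms(1)]] smooth_on_scaleR smooth_on_diff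
        smooth_on_const smooth_on_ident open_UNIV subset_UNIV)
  moreover have "compact ((\<lambda>w. X + (1 / a) *\<^sub>R w) ` C)"
    by (intro compact_continuous_image C(1) continuous_intros)
  moreover have "\<psi> (a *\<^sub>R (z - X)) = 0" if "z \<notin> (\<lambda>w. X + (1 / a) *\<^sub>R w) ` C" for z
  proof (rule C(2))
    show "a *\<^sub>R (z - X) \<notin> C"
      using that assms(2) by (auto simp: image_iff)
  qed
  ultimately show ?thesis unfolding C0_infty_def by blast
qed

lemma C0_infty_continuous:
  "\<psi> \<in> C0_infty UNIV \<Longrightarrow> continuous_on UNIV \<psi>"
  by (simp add: C0_inftyD smooth_on_continuous)

lemma C0_infty_bounded:
  fixes \<psi> :: "'a::euclidean_space \<Rightarrow> 'b::real_normed_vector"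
  assumes "\<psi> \<in> C0_infty UNIV"
  obtains B where "\<And>x. norm (\<psi> x) \<le> B" "B > 0"
proof -
  obtain C where C: "compact C" "\<And>x. x \<notin> C \<Longrightarrow> \<psi> x = 0"
    using assms unfolding C0_infty_def by auto
  have "bounded (\<psi> ` C)"
    using C(1) continuous_on_subset[OF C0_infty_continuous[OF assms]]
    by (intro compact_imp_bounded compact_continuous_image) auto
  then obtain B where B: "B > 0" "\<And>x. x \<in> C \<Longrightarrow> norm (\<psi> x) \<le> B"
    unfolding bounded_pos by auto
  show thesis
    by (rule that[of B]) (use B C(2) in \<open>auto, metis less_imp_le norm_zero\<close>)
qed

section \<open>The fundamental lemma of the calculus of variations\<close>

text \<open>Smooth functions approximating the indicator function of an open box from below.\<close>

definition box_bump :: "'a::euclidean_space \<Rightarrow> 'a \<Rightarrow> nat \<Rightarrow> 'a \<Rightarrow> real" where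
  "box_bump a b n x =
     (\<Prod>i\<in>Basis. flat 0 (real (Suc n) * (x \<bullet> i - a \<bullet> i)) * flat 0 (real (Suc n) * (b \<bullet> i - x \<bullet> i)))"

lemma flat_0_range: "0 \<le> flat 0 t" "flat 0 t \<le> 1"
  by (auto simp: flat_def)

lemma box_bump_range: "0 \<le> box_bump a b n x" "box_bump a b n x \<le> 1"
  unfolding box_bump_def
  by (intro prod_nonneg prod_le_1 mult_nonneg_nonneg mult_le_one conjI flat_0_range)+

lemma box_bump_eq_0: "x \<notin> box a b \<Longrightarrow> box_bump a b n x = 0"
  unfolding box_bump_def
  by (rule prod_zero) (auto simp: mem_box flat_def zero_less_mult_iff)

lemma smooth_on_box_bump: "smooth_on UNIV (box_bump a b n)"
  unfolding box_bump_def[abs_def]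
proof (intro smooth_on_prod smooth_on_mult open_UNIV)
  show "smooth_on UNIV (\<lambda>x. flat 0 (real (Suc n) * (x \<bullet> i - a \<bullet> i)))" for i
    by (rule smooth_on_compose[OF open_UNIV _ smooth_on_flat])
      (auto intro!: smooth_on_mult smooth_on_diff smooth_on_const smooth_on_inner smooth_on_ident)
  show "smooth_on UNIV (\<lambda>x. flat 0 (real (Suc n) * (b \<bullet> i - x \<bullet> i)))" for i
    by (rule smooth_on_compose[OF open_UNIV _ smooth_on_flat])
      (auto intro!: smooth_on_mult smooth_on_diff smooth_on_const smooth_on_inner smooth_on_ident)
qed

lemma box_bump_C0_infty:
  assumes "cbox a b \<subseteq> S" shows "box_bump a b n \<in> C0_infty S"
proof -
  have "box_bump a b n x = 0" if "x \<in> S - cbox a b" for x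
    by (rule box_bump_eq_0) (use that box_subset_cbox[of a b] in blast)
  then show ?thesis
    unfolding C0_infty_def using assms smooth_on_subset[OF smooth_on_box_bump subset_UNIV, of S a b n]
    by (intro CollectI conjI exI[of _ "cbox a b"] ballI) simp_all
qed

lemma flat_scaled_tendsto_1: "t > 0 \<Longrightarrow> (\<lambda>n. flat 0 (real (Suc n) * t)) \<longlonglongrightarrow> 1"
proof -
  assume t: "t > 0"
  have "(\<lambda>n. exp (- (inverse (real (Suc n)) * (1 / t)))) \<longlonglongrightarrow> exp (- (0 * (1 / t)))"
    by (intro tendsto_intros LIMSEQ_inverse_real_of_nat)
  moreover have "flat 0 (real (Suc n) * t) = exp (- (inverse (real (Suc n)) * (1 / t)))" for n
    using t by (simp add: flat_def zero_less_mult_iff divide_inverse)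
  ultimately show ?thesis by simp
qed

lemma box_bump_tendsto: "(\<lambda>n. box_bump a b n x) \<longlonglongrightarrow> indicator (box a b) x"
proof (cases "x \<in> box a b")
  case True
  have "(\<lambda>n. box_bump a b n x) \<longlonglongrightarrow> (\<Prod>i\<in>(Basis::'a set). 1 * 1)"
    unfolding box_bump_def
    by (intro tendsto_intros flat_scaled_tendsto_1) (use True in \<open>auto simp: mem_box\<close>)
  then show ?thesis using True by simp
qed (simp add: box_bump_eq_0)

text \<open>Dominated convergence along the bumps, with the norm of g on the closed box as majorant,
  gives a zero integral over the open box; the faces of the box do not contribute.\<close>

lemma fundamental_lemma_box:
  fixes g :: "'a::euclidean_space \<Rightarrow> 'b::euclidean_space"
  assumes "loc_integrable S g"
    and test: "\<And>\<phi>. \<phi> \<in> C0_infty S \<Longrightarrow> (LINT x:S|lebesgue. \<phi> x *\<^sub>R g x) = 0"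
    and ab: "cbox a b \<subseteq> S"
  shows "integral (cbox a b) g = 0"
proof -
  have int: "set_integrable lebesgue (cbox a b) g"
    using assms(1) ab by (auto simp: loc_integrable_def)
  have int': "set_integrable lebesgue (box a b) g"
    by (rule set_integrable_subset[OF int]) (auto simp: box_subset_cbox)
  \<comment> \<open>g is only locally integrable, so it is cut off to the closed box before limits
    are taken. The cut-off is invisible to the bump, which vanishes off the open box.\<close>
  have bump: "box_bump a b n x *\<^sub>R (indicator (cbox a b) x *\<^sub>R g x) = indicator S x *\<^sub>R (box_bump a b n x *\<^sub>R g x)" for n x
    using box_bump_eq_0[of x a b n] box_subset_cbox[of a b] ab by (auto simp: indicator_def)
  have 0: "(LINT x|lebesgue. box_bump a b n x *\<^sub>R (indicator (cbox a b) x *\<^sub>R g x)) = 0" for n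
    unfolding bump using test[OF box_bump_C0_infty[OF ab]] by (simp add: set_lebesgue_integral_def)
  have "(\<lambda>n. LINT x|lebesgue. box_bump a b n x *\<^sub>R (indicator (cbox a b) x *\<^sub>R g x))
    \<longlonglongrightarrow> (LINT x|lebesgue. indicator (box a b) x *\<^sub>R (indicator (cbox a b) x *\<^sub>R g x))"
  proof (rule integral_dominated_convergence[where w = "\<lambda>x. norm (indicator (cbox a b) x *\<^sub>R g x)"])
    have m: "(\<lambda>x. indicator (cbox a b) x *\<^sub>R g x) \<in> borel_measurable lebesgue"
      using int by (simp add: set_integrable_def)
    have bm: "box_bump a b n \<in> borel_measurable lebesgue" for n
      using borel_measurable_continuous_onI[OF smooth_on_continuous[OF smooth_on_box_bump]]
      by (intro measurable_completion) simp
    show "(\<lambda>x. box_bump a b n x *\<^sub>R indicat_real (cbox a b) x *\<^sub>R g x) \<in> borel_measurable lebesgue" for n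
      using bm m by (rule borel_measurable_scaleR)
    show "(\<lambda>x. indicat_real (box a b) x *\<^sub>R indicat_real (cbox a b) x *\<^sub>R g x) \<in> borel_measurable lebesgue"
      by (rule borel_measurable_scaleR[OF borel_measurable_indicator m]) simp
    show "integrable lebesgue (\<lambda>x. norm (indicat_real (cbox a b) x *\<^sub>R g x))"
      using int unfolding set_integrable_def by (rule integrable_norm)
    show "AE x in lebesgue. (\<lambda>n. box_bump a b n x *\<^sub>R indicat_real (cbox a b) x *\<^sub>R g x)
         \<longlonglongrightarrow> indicat_real (box a b) x *\<^sub>R indicat_real (cbox a b) x *\<^sub>R g x"
      by (intro AE_I2 tendsto_scaleR box_bump_tendsto tendsto_const)
    show "AE x in lebesgue. norm (box_bump a b n x *\<^sub>R indicat_real (cbox a b) x *\<^sub>R g x)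
         \<le> norm (indicat_real (cbox a b) x *\<^sub>R g x)" for n
      using box_bump_range[of a b n] by (intro AE_I2) (auto simp: indicator_def mult_left_le_one_le)
  qed
  then have "(LINT x|lebesgue. indicator (box a b) x *\<^sub>R (indicator (cbox a b) x *\<^sub>R g x)) = 0"
    unfolding 0 by (simp add: LIMSEQ_const_iff)
  moreover have "(\<lambda>x. indicator (box a b) x *\<^sub>R (indicator (cbox a b) x *\<^sub>R g x)) = (\<lambda>x. indicator (box a b) x *\<^sub>R g x)"
    using box_subset_cbox[of a b] by (intro ext) (auto simp: indicator_def)
  ultimately have "(LINT x:box a b|lebesgue. g x) = 0"
    by (simp only: set_lebesgue_integral_def)
  then show ?thesis
    using set_lebesgue_integral_eq_integral(2)[OF int'] by (simp add: integral_open_interval)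
qed

text \<open>By Lebesgue differentiation, almost every value is a limit of averages over small cubes
  with corner x, and all these averages vanish. Since g is only locally integrable, this is done
  inside a box around each point and then globalised by the local characterisation of negligible
  sets.\<close>

lemma fundamental_lemma:
  fixes g :: "'a::euclidean_space \<Rightarrow> 'b::euclidean_space"
  assumes "open S" "loc_integrable S g"
    and test: "\<And>\<phi>. \<phi> \<in> C0_infty S \<Longrightarrow> (LINT x:S|lebesgue. \<phi> x *\<^sub>R g x) = 0"
  shows "negligible {x \<in> S. g x \<noteq> 0}"
  unfolding locally_negligible_alt[of "{x \<in> S. g x \<noteq> 0}"]
proof
  fix x0 assume "x0 \<in> {x \<in> S. g x \<noteq> 0}"
  then have x0: "x0 \<in> S" "g x0 \<noteq> 0" by auto
  obtain a b where ab: "cbox a b \<subseteq> S" "x0 \<in> box a b"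
    using open_contains_cbox[OF assms(1) x0(1)] by metis
  define f where "f x = (if x \<in> cbox a b then g x else 0)" for x
  have "set_integrable lebesgue (cbox a b) g"
    using assms(2) ab by (auto simp: loc_integrable_def)
  then have "g integrable_on cbox a b" by (rule set_lebesgue_integral_eq_integral(1))
  then have "f integrable_on UNIV" unfolding f_def by (simp add: integrable_restrict_UNIV)
  then have fint: "f integrable_on cbox c d" for c d
    using integrable_on_subcbox by blast
  obtain N where N: "negligible N"
    "\<And>x e. x \<notin> N \<Longrightarrow> 0 < e \<Longrightarrow>
       \<exists>d>0. \<forall>h. 0 < h \<and> h < d \<longrightarrow> norm (integral (cbox x (x + h *\<^sub>R One)) f /\<^sub>R h ^ DIM('a) - f x) < e"
    using integrable_ccontinuous_explicit[OF fint] by metis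
  have "f x = 0" if x: "x \<in> box a b" "x \<notin> N" for x
  proof (rule ccontr)
    assume "f x \<noteq> 0"
    then obtain d where d: "d > 0"
      "\<And>h. 0 < h \<Longrightarrow> h < d \<Longrightarrow> norm (integral (cbox x (x + h *\<^sub>R One)) f /\<^sub>R h ^ DIM('a) - f x) < norm (f x)"
      using N(2)[OF x(2), of "norm (f x)"] by auto
    \<comment> \<open>The least distance from x to the upper faces: a cube with lower corner x and
      side at most r stays in the box. Halving d below yields a side strictly less than d.\<close>
    define r where "r = Min ((\<lambda>i. b \<bullet> i - x \<bullet> i) ` Basis)"
    have r: "r > 0" "\<And>i. i \<in> Basis \<Longrightarrow> r \<le> b \<bullet> i - x \<bullet> i"
      using x(1) by (auto simp: r_def mem_box)
    define h where "h = min (d / 2) r"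
    have h: "0 < h" "h < d" "h \<le> r" using d(1) r(1) by (auto simp: h_def)
    have sub: "cbox x (x + h *\<^sub>R One) \<subseteq> cbox a b"
    proof
      fix y assume y: "y \<in> cbox x (x + h *\<^sub>R One)"
      show "y \<in> cbox a b"
        unfolding mem_box
      proof
        fix i :: 'a assume i: "i \<in> Basis"
        show "a \<bullet> i \<le> y \<bullet> i \<and> y \<bullet> i \<le> b \<bullet> i"
          using x(1) y h(3) r(2)[OF i] i by (fastforce simp: mem_box inner_add_left)
      qed
    qed
    have "integral (cbox x (x + h *\<^sub>R One)) f = integral (cbox x (x + h *\<^sub>R One)) g"
      by (rule integral_cong) (use sub in \<open>auto simp: f_def\<close>)
    also have "\<dots> = 0"
      by (rule fundamental_lemma_box[OF assms(2) test]) (use sub ab in auto)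
    finally show False using d(2)[OF h(1,2)] by simp
  qed
  then have "{x \<in> S. g x \<noteq> 0} \<inter> box a b \<subseteq> N"
    using box_subset_cbox[of a b] by (force simp: f_def)
  then have "negligible ({x \<in> S. g x \<noteq> 0} \<inter> box a b)"
    using N(1) negligible_subset by blast
  then show "\<exists>U. openin (top_of_set {x \<in> S. g x \<noteq> 0}) U \<and> x0 \<in> U \<and> negligible U"
    using x0 ab by (intro exI[of _ "{x \<in> S. g x \<noteq> 0} \<inter> box a b"]) auto
qed

section \<open>Convolution with a test function\<close>

lemma C0_infty_translate:
  fixes \<psi> :: "'a::euclidean_space \<Rightarrow> 'b::real_normed_vector"
  shows "\<psi> \<in> C0_infty UNIV \<Longrightarrow> (\<lambda>z. \<psi> (z - X)) \<in> C0_infty UNIV"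
  using C0_infty_affine[of \<psi> 1 X] by simp

lemma frechet_derivative_translate:
  fixes \<psi> :: "'a::real_normed_vector \<Rightarrow> 'b::real_normed_vector"
  assumes "\<psi> differentiable (at (z - X))"
  shows "frechet_derivative (\<lambda>z. \<psi> (z - X)) (at z) = frechet_derivative \<psi> (at (z - X))"
proof -
  have "((\<lambda>z. z - X) has_derivative (\<lambda>v. v)) (at z)"
    by (auto intro!: derivative_eq_intros)
  from has_derivative_compose[OF this, of \<psi> "frechet_derivative \<psi> (at (z - X))"] assms
  have "((\<lambda>z. \<psi> (z - X)) has_derivative frechet_derivative \<psi> (at (z - X))) (at z)"
    by (simp add: frechet_derivative_works)
  from frechet_derivative_at[OF this] show ?thesis by simp
qed

lemma integrable_C0_infty_scaleR:
  fixes \<phi> :: "'a::euclidean_space \<Rightarrow> real" and f :: "'a \<Rightarrow> 'b::euclidean_space"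
  assumes "\<phi> \<in> C0_infty UNIV" "integrable lebesgue f"
  shows "integrable lebesgue (\<lambda>z. \<phi> z *\<^sub>R f z)"
proof -
  obtain B where B: "\<And>x. norm (\<phi> x) \<le> B" "B > 0" using C0_infty_bounded[OF assms(1)] by metis
  have m: "\<phi> \<in> borel_measurable lebesgue"
    using borel_measurable_continuous_onI[OF C0_infty_continuous[OF assms(1)]]
    by (intro measurable_completion) simp
  show ?thesis
  proof (rule Bochner_Integration.integrable_bound[of _ "\<lambda>z. B *\<^sub>R f z"])
    show "integrable lebesgue (\<lambda>z. B *\<^sub>R f z)" using assms(2) by simp
    show "(\<lambda>z. \<phi> z *\<^sub>R f z) \<in> borel_measurable lebesgue"
      by (rule borel_measurable_scaleR[OF m borel_measurable_integrable[OF assms(2)]])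
    show "AE x in lebesgue. norm (\<phi> x *\<^sub>R f x) \<le> norm (B *\<^sub>R f x)"
      using B by (intro AE_I2) (simp add: mult_right_mono)
  qed
qed

text \<open>Strictly a correlation, that is, the convolution with the reflected kernel. This form
  matches the substitution z = X + \<epsilon> y, and \<psi>(z - X) as a function of z is directly a
  test function for the weak derivatives.\<close>

definition conv :: "('a::euclidean_space \<Rightarrow> real) \<Rightarrow> ('a \<Rightarrow> 'b::euclidean_space) \<Rightarrow> 'a \<Rightarrow> 'b" where
  "conv \<psi> f X = (LINT z|lebesgue. \<psi> (z - X) *\<^sub>R f z)"

text \<open>The two uniform bounds supply the integrable majorant when difference quotients pass
  under the integral. They come from the finitely many partial derivatives, each bounded by compact
  support, and from the mean value inequality.\<close>

lemma C0_infty_derivative_bound: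
  fixes \<psi> :: "'a::euclidean_space \<Rightarrow> real"
  assumes "\<psi> \<in> C0_infty UNIV"
  obtains B where "B > 0" "\<And>x v. \<bar>frechet_derivative \<psi> (at x) v\<bar> \<le> B * norm v"
    "\<And>x y. \<bar>\<psi> x - \<psi> y\<bar> \<le> B * norm (x - y)"
proof -
  have "\<exists>B. \<forall>x. \<bar>frechet_derivative \<psi> (at x) b\<bar> \<le> B" for b
    using C0_infty_bounded[OF C0_infty_frechet[OF open_UNIV assms], of b] by (metis real_norm_def)
  then obtain B where B: "\<And>b x. \<bar>frechet_derivative \<psi> (at x) b\<bar> \<le> B b" by metis
  have B0: "B b \<ge> 0" for b using B[of undefined b] by linarith
  define M where "M = 1 + (\<Sum>b\<in>Basis. B b)"
  have M: "M > 0" unfolding M_def using B0 by (simp add: add_pos_nonneg sum_nonneg)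
  have der: "(\<psi> has_derivative frechet_derivative \<psi> (at x)) (at x)" for x
    using smooth_on_has_derivative[OF C0_inftyD[OF assms]] by simp
  have bnd: "\<bar>frechet_derivative \<psi> (at x) v\<bar> \<le> M * norm v" for x v
  proof -
    have lin: "linear (frechet_derivative \<psi> (at x))" by (rule has_derivative_linear[OF der])
    have "frechet_derivative \<psi> (at x) (\<Sum>b\<in>Basis. (v \<bullet> b) *\<^sub>R b) = (\<Sum>b\<in>Basis. (v \<bullet> b) * frechet_derivative \<psi> (at x) b)"
      using lin by (simp add: linear_sum linear_scale)
    then have "frechet_derivative \<psi> (at x) v = (\<Sum>b\<in>Basis. (v \<bullet> b) * frechet_derivative \<psi> (at x) b)"
      by (simp add: euclidean_representation)
    also have "\<bar>\<dots>\<bar> \<le> (\<Sum>b\<in>Basis. norm v * B b)"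
      by (rule order_trans[OF sum_abs sum_mono])
        (auto simp: abs_mult intro!: mult_mono B Basis_le_norm)
    also have "\<dots> \<le> M * norm v"
      unfolding sum_distrib_left[symmetric] M_def by (simp add: algebra_simps)
    finally show ?thesis .
  qed
  have "\<bar>\<psi> x - \<psi> y\<bar> \<le> M * norm (x - y)" for x y
  proof -
    have "norm (\<psi> x - \<psi> y) \<le> M * norm (x - y)"
      by (rule differentiable_bound[OF convex_UNIV, where f' = "\<lambda>x. frechet_derivative \<psi> (at x)"])
        (use der bnd M in \<open>auto intro!: onorm_bound\<close>)
    then show ?thesis by simp
  qed
  then show thesis using that M bnd by blast
qed

lemma conv_linear_combination:
  fixes f :: "'a::euclidean_space \<Rightarrow> 'b::euclidean_space"
  assumes "\<psi> \<in> C0_infty UNIV" "\<phi> \<in> C0_infty UNIV" "integrable lebesgue f"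
  shows "conv (\<lambda>w. \<psi> w + \<phi> w) f X = conv \<psi> f X + conv \<phi> f X"
    "conv (\<lambda>w. c * \<psi> w) f X = c *\<^sub>R conv \<psi> f X"
  using integrable_C0_infty_scaleR[OF C0_infty_translate[OF assms(1)] assms(3), of X]
    integrable_C0_infty_scaleR[OF C0_infty_translate[OF assms(2)] assms(3), of X]
  by (simp_all add: conv_def scaleR_add_left scaleR_scaleR[symmetric] del: scaleR_scaleR)

lemma C0_infty_minus_frechet:
  fixes \<psi> :: "'a::euclidean_space \<Rightarrow> real"
  shows "\<psi> \<in> C0_infty UNIV \<Longrightarrow> (\<lambda>w. - frechet_derivative \<psi> (at w) v) \<in> C0_infty UNIV"
  by (rule C0_infty_bounded_linear[OF open_UNIV bounded_linear_minus[OF bounded_linear_ident]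
        C0_infty_frechet[OF open_UNIV]])

text \<open>All differences fall on the kernel, so f need only be integrable: the quotients
  \<open>q n\<close> are bounded by 2 B, one B from the Lipschitz estimate and one from the
  derivative bound. Dominated convergence speaks of sequences, hence the limit at 0 is tested along
  null sequences.\<close>

lemma conv_has_derivative:
  fixes f :: "'a::euclidean_space \<Rightarrow> 'b::euclidean_space"
  assumes \<psi>: "\<psi> \<in> C0_infty UNIV" and f: "integrable lebesgue f"
  shows "(conv \<psi> f has_derivative (\<lambda>v. conv (\<lambda>w. - frechet_derivative \<psi> (at w) v) f X)) (at X)"
proof -
  let ?\<psi>' = "\<lambda>w. frechet_derivative \<psi> (at w)"
  let ?L = "\<lambda>v. conv (\<lambda>w. - ?\<psi>' w v) f X"
  obtain B where B: "B > 0" "\<And>x v. \<bar>?\<psi>' x v\<bar> \<le> B * norm v"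
    "\<And>x y. \<bar>\<psi> x - \<psi> y\<bar> \<le> B * norm (x - y)"
    using C0_infty_derivative_bound[OF \<psi>] by metis
  have der: "(\<psi> has_derivative ?\<psi>' x) (at x)" for x
    using smooth_on_has_derivative[OF C0_inftyD[OF \<psi>]] by simp
  have lin: "linear (?\<psi>' x)" for x by (rule has_derivative_linear[OF der])
  have "linear ?L"
  proof (rule linearI)
    show "?L (u + v) = ?L u + ?L v" for u v
      using conv_linear_combination(1)[OF C0_infty_minus_frechet[OF \<psi>] C0_infty_minus_frechet[OF \<psi>] f, of u v X]
      by (simp add: linear_add[OF lin])
    show "?L (c *\<^sub>R v) = c *\<^sub>R ?L v" for c v
      using conv_linear_combination(2)[OF C0_infty_minus_frechet[OF \<psi>] \<psi> f, of c v X]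
      by (simp add: linear_scale[OF lin])
  qed
  then have bl: "bounded_linear ?L" by (simp add: linear_conv_bounded_linear)
  have "(\<lambda>n. norm (conv \<psi> f (X + h n) - conv \<psi> f X - ?L (h n)) / norm (h n)) \<longlonglongrightarrow> 0"
    if h: "\<And>n. h n \<noteq> 0" "h \<longlonglongrightarrow> 0" for h
  proof -
    \<comment> \<open>The derivative term enters with a plus sign because moving X by
      \<open>h n\<close> moves the argument of \<psi> by \<open>- h n\<close>.\<close>
    define q where "q n z = (\<psi> (z - X - h n) - \<psi> (z - X) + ?\<psi>' (z - X) (h n)) / norm (h n)" for n z
    have i1: "integrable lebesgue (\<lambda>z. \<psi> (z - X - h n) *\<^sub>R f z)" for n
      using integrable_C0_infty_scaleR[OF C0_infty_translate[OF \<psi>] f, of "X + h n"]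
      by (simp add: diff_diff_eq)
    have i2: "integrable lebesgue (\<lambda>z. \<psi> (z - X) *\<^sub>R f z)"
      by (rule integrable_C0_infty_scaleR[OF C0_infty_translate[OF \<psi>] f])
    have i3: "integrable lebesgue (\<lambda>z. (- ?\<psi>' (z - X) (h n)) *\<^sub>R f z)" for n
      by (rule integrable_C0_infty_scaleR[OF C0_infty_translate[OF C0_infty_minus_frechet[OF \<psi>]] f])
    have q: "q n z *\<^sub>R f z = (1 / norm (h n)) *\<^sub>R
        (\<psi> (z - X - h n) *\<^sub>R f z - \<psi> (z - X) *\<^sub>R f z - (- ?\<psi>' (z - X) (h n)) *\<^sub>R f z)" for n z
      unfolding q_def by (simp add: scaleR_diff_left[symmetric] scaleR_add_left[symmetric] del: scaleR_left.add)
    have iq: "integrable lebesgue (\<lambda>z. q n z *\<^sub>R f z)" for n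
      unfolding q by (intro integrable_scaleR_right Bochner_Integration.integrable_diff i1 i2 i3)
    have eq: "(LINT z|lebesgue. q n z *\<^sub>R f z) =
        (1 / norm (h n)) *\<^sub>R (conv \<psi> f (X + h n) - conv \<psi> f X - ?L (h n))" for n
    proof -
      have "(LINT z|lebesgue. q n z *\<^sub>R f z) = (1 / norm (h n)) *\<^sub>R
         ((LINT z|lebesgue. \<psi> (z - X - h n) *\<^sub>R f z) - (LINT z|lebesgue. \<psi> (z - X) *\<^sub>R f z)
           - (LINT z|lebesgue. (- ?\<psi>' (z - X) (h n)) *\<^sub>R f z))"
        unfolding q integral_scaleR_right
        by (simp only: Bochner_Integration.integral_diff[OF Bochner_Integration.integrable_diff[OF i1 i2] i3]
            Bochner_Integration.integral_diff[OF i1 i2])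
      then show ?thesis by (simp add: conv_def diff_diff_eq)
    qed
    have "(\<lambda>n. LINT z|lebesgue. q n z *\<^sub>R f z) \<longlonglongrightarrow> (LINT z|(lebesgue :: 'a measure). (0 :: 'b))"
    proof (rule integral_dominated_convergence[where w = "\<lambda>z. (2 * B) *\<^sub>R norm (f z)"])
      show "(\<lambda>z. q n z *\<^sub>R f z) \<in> borel_measurable lebesgue" for n
        using iq by (rule borel_measurable_integrable)
      show "integrable lebesgue (\<lambda>z. (2 * B) *\<^sub>R norm (f z))"
        using f by (intro integrable_scaleR_right integrable_norm)
      show "AE z in lebesgue. (\<lambda>n. q n z *\<^sub>R f z) \<longlonglongrightarrow> 0"
      proof (rule AE_I2)
        fix z
        have "(\<lambda>k. norm (\<psi> (z - X + k) - \<psi> (z - X) - ?\<psi>' (z - X) k) / norm k) \<midarrow>0\<rightarrow> 0"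
          using der[of "z - X"] by (simp add: has_derivative_at)
        moreover have "filterlim (\<lambda>n. - h n) (at 0) sequentially"
          using h tendsto_minus[OF h(2)] by (auto simp: filterlim_at)
        ultimately have "(\<lambda>n. norm (\<psi> (z - X + - h n) - \<psi> (z - X) - ?\<psi>' (z - X) (- h n)) / norm (- h n)) \<longlonglongrightarrow> 0"
          by (rule filterlim_compose)
        moreover have "norm (\<psi> (z - X + - h n) - \<psi> (z - X) - ?\<psi>' (z - X) (- h n)) / norm (- h n) = norm (q n z)" for n
          by (simp add: q_def linear_neg[OF lin])
        ultimately have "(\<lambda>n. q n z) \<longlonglongrightarrow> 0" by (simp add: tendsto_rabs_zero_iff)
        then have "(\<lambda>n. q n z *\<^sub>R f z) \<longlonglongrightarrow> 0 *\<^sub>R f z" by (intro tendsto_intros)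
        then show "(\<lambda>n. q n z *\<^sub>R f z) \<longlonglongrightarrow> 0" by simp
      qed
      show "AE z in lebesgue. norm (q n z *\<^sub>R f z) \<le> (2 * B) *\<^sub>R norm (f z)" for n
      proof (rule AE_I2)
        fix z
        have "\<bar>\<psi> (z - X - h n) - \<psi> (z - X) + ?\<psi>' (z - X) (h n)\<bar> \<le> B * norm (h n) + B * norm (h n)"
          using B(3)[of "z - X - h n" "z - X"] B(2)[of "z - X" "h n"] by simp
        then have "\<bar>q n z\<bar> \<le> 2 * B"
          using h(1)[of n] by (simp add: q_def divide_le_eq)
        then show "norm (q n z *\<^sub>R f z) \<le> (2 * B) *\<^sub>R norm (f z)"
          by (simp add: mult_right_mono)
      qed
    qed simp
    then have "(\<lambda>n. norm (LINT z|lebesgue. q n z *\<^sub>R f z)) \<longlonglongrightarrow> 0"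
      by (simp add: tendsto_norm_zero)
    then show ?thesis by (simp add: eq divide_inverse mult.commute)
  qed
  then have "(\<lambda>h. norm (conv \<psi> f (X + h) - conv \<psi> f X - ?L h) / norm h) \<midarrow>0\<rightarrow> 0"
    unfolding tendsto_at_iff_sequentially by (auto simp: o_def)
  then show ?thesis using bl by (simp add: has_derivative_at)
qed

lemma frechet_conv:
  fixes f :: "'a::euclidean_space \<Rightarrow> 'b::euclidean_space"
  assumes "\<psi> \<in> C0_infty UNIV" "integrable lebesgue f"
  shows "frechet_derivative (conv \<psi> f) (at X) v = - (LINT z|lebesgue. frechet_derivative \<psi> (at (z - X)) v *\<^sub>R f z)"
  using frechet_derivative_at[OF conv_has_derivative[OF assms, of X], symmetric]
  by (simp add: conv_def)

text \<open>A directional derivative of \<open>conv \<psi> f\<close> is again of this form, with the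
  kernel replaced by minus a derivative of \<psi>. The induction therefore has to quantify over all
  kernels.\<close>

lemma smooth_on_conv:
  fixes f :: "'a::euclidean_space \<Rightarrow> 'b::euclidean_space"
  assumes "\<psi> \<in> C0_infty UNIV" and f: "integrable lebesgue f"
  shows "smooth_on UNIV (conv \<psi> f)"
proof -
  have "\<forall>\<psi>\<in>C0_infty UNIV. Ck_on n UNIV (conv \<psi> f)" for n
  proof (induction n)
    case 0
    show ?case
      using has_derivative_continuous[OF conv_has_derivative[OF _ f]]
      by (simp add: continuous_at_imp_continuous_on)
  next
    case (Suc n)
    show ?case
      using Ck_on_SucI[OF open_UNIV conv_has_derivative[OF _ f]] Suc.IH C0_infty_minus_frechet by blast
  qed
  then show ?thesis using assms(1) by (simp add: smooth_on_def)
qed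

lemma conv_bounded_linear:
  fixes f :: "'a::euclidean_space \<Rightarrow> 'b::euclidean_space" and h :: "'b \<Rightarrow> 'c::euclidean_space"
  assumes "bounded_linear h" "\<psi> \<in> C0_infty UNIV" "integrable lebesgue f"
  shows "conv \<psi> (\<lambda>z. h (f z)) X = h (conv \<psi> f X)"
proof -
  have "(LINT z|lebesgue. h (\<psi> (z - X) *\<^sub>R f z)) = h (LINT z|lebesgue. \<psi> (z - X) *\<^sub>R f z)"
    by (rule integral_bounded_linear[OF assms(1) integrable_C0_infty_scaleR[OF C0_infty_translate[OF assms(2)] assms(3)]])
  then show ?thesis
    by (simp add: conv_def linear_scale[OF bounded_linear.linear[OF assms(1)]])
qed

subsection \<open>Weak derivatives become classical\<close>

lemma grad_translate:
  assumes "\<psi> \<in> C0_infty UNIV"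
  shows "grad (\<lambda>z. \<psi> (z - X)) z = grad \<psi> (z - X)"
  using smooth_on_differentiable[OF C0_inftyD[OF assms]]
  by (simp add: vec_eq_iff grad_nth frechet_derivative_translate)

lemma integrable_C0_infty_vec:
  fixes \<Phi> :: "real^3 \<Rightarrow> real^3"
  assumes "\<Phi> \<in> C0_infty UNIV"
  shows "integrable lebesgue (f :: _ \<Rightarrow> real) \<Longrightarrow> integrable lebesgue (\<lambda>z. f z *\<^sub>R \<Phi> z)"
    and "integrable lebesgue (g :: _ \<Rightarrow> real^3) \<Longrightarrow> integrable lebesgue (\<lambda>z. g z \<bullet> \<Phi> z)"
proof -
  assume "integrable lebesgue f"
  then have "integrable lebesgue (\<lambda>z. \<Sum>i\<in>UNIV. (\<Phi> z $ i *\<^sub>R f z) *\<^sub>R axis i (1::real))"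
    by (intro Bochner_Integration.integrable_sum integrable_scaleR_left
        integrable_C0_infty_scaleR[OF C0_infty_nth[OF open_UNIV assms]])
  moreover have "(\<Sum>i\<in>UNIV. (\<Phi> z $ i *\<^sub>R f z) *\<^sub>R axis i (1::real)) = f z *\<^sub>R \<Phi> z" for z
    by (simp add: vec_eq_iff axis_def if_distrib cong: if_cong)
  ultimately show "integrable lebesgue (\<lambda>z. f z *\<^sub>R \<Phi> z)" by simp
next
  assume "integrable lebesgue g"
  then have "integrable lebesgue (\<lambda>z. \<Sum>i\<in>UNIV. \<Phi> z $ i *\<^sub>R (g z $ i))"
    by (intro Bochner_Integration.integrable_sum integrable_C0_infty_scaleR[OF C0_infty_nth[OF open_UNIV assms]]
        integrable_bounded_linear[OF bounded_linear_vec_nth])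
  then show "integrable lebesgue (\<lambda>z. g z \<bullet> \<Phi> z)"
    by (simp add: inner_vec_def mult.commute)
qed

text \<open>The translated kernel is the test function. The minus sign from differentiating in X
  cancels the one from integration by parts.\<close>

lemma grad_conv:
  assumes w: "weak_grad UNIV f G" and int: "integrable lebesgue f" "integrable lebesgue G"
    and \<psi>: "\<psi> \<in> C0_infty UNIV"
  shows "grad (conv \<psi> f) X = conv \<psi> G X"
proof -
  let ?\<phi> = "\<lambda>z. \<psi> (z - X)"
  have "(LINT z|lebesgue. f z *\<^sub>R grad ?\<phi> z) = - (LINT z|lebesgue. ?\<phi> z *\<^sub>R G z)"
    using w C0_infty_translate[OF \<psi>, of X]
    by (simp add: weak_grad_def set_lebesgue_integral_def)
  then have "(LINT z|lebesgue. (f z *\<^sub>R grad ?\<phi> z) $ i) = - conv \<psi> G X $ i" for i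
    using integral_bounded_linear[OF bounded_linear_vec_nth[of i]
        integrable_C0_infty_vec(1)[OF C0_infty_grad[OF open_UNIV C0_infty_translate[OF \<psi>, of X]] int(1)]]
    by (simp add: conv_def)
  then show ?thesis
    by (simp add: vec_eq_iff grad_nth frechet_conv[OF \<psi> int(1)] grad_translate[OF \<psi>] mult.commute)
qed

lemma divergence_conv:
  assumes w: "weak_div UNIV g w" and int: "integrable lebesgue g" "integrable lebesgue w"
    and \<psi>: "\<psi> \<in> C0_infty UNIV"
  shows "divergence (conv \<psi> g) X = conv \<psi> w X"
proof -
  let ?\<phi> = "\<lambda>z. \<psi> (z - X)"
  have eq: "(LINT z|lebesgue. g z \<bullet> grad ?\<phi> z) = - conv \<psi> w X"
    using w C0_infty_translate[OF \<psi>, of X]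
    by (simp add: weak_div_def set_lebesgue_integral_def conv_def mult.commute)
  have i: "integrable lebesgue (\<lambda>z. frechet_derivative \<psi> (at (z - X)) v *\<^sub>R g z)" for v
    by (rule integrable_C0_infty_scaleR[OF C0_infty_translate[OF C0_infty_frechet[OF open_UNIV \<psi>]] int(1)])
  have nth: "frechet_derivative (conv \<psi> g) (at X) v $ j =
      - (LINT z|lebesgue. frechet_derivative \<psi> (at (z - X)) v * g z $ j)" for v j
    using integral_bounded_linear[OF bounded_linear_vec_nth[of j] i]
    by (simp add: frechet_conv[OF \<psi> int(1)])
  have i': "integrable lebesgue (\<lambda>z. frechet_derivative \<psi> (at (z - X)) v * g z $ j)" for v j
    using integrable_bounded_linear[OF bounded_linear_vec_nth[of j] i] by simp
  have "(LINT z|lebesgue. g z \<bullet> grad ?\<phi> z) =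
      (LINT z|lebesgue. (\<Sum>j\<in>UNIV. frechet_derivative \<psi> (at (z - X)) (axis j 1) * g z $ j))"
    by (simp add: inner_vec_def grad_translate[OF \<psi>] grad_nth mult.commute)
  also have "\<dots> = - divergence (conv \<psi> g) X"
    by (subst Bochner_Integration.integral_sum[OF i'])
      (simp add: divergence_def jacobian_nth nth sum_negf)
  finally show ?thesis using eq by simp
qed

text \<open>Testing with the translated kernel times the k-th unit vector extracts the k-th
  component of the weak curl, while the curl of such a test field involves only two partial
  derivatives of \<psi>.\<close>

lemma curl_conv:
  assumes w: "weak_curl UNIV g w" and int: "integrable lebesgue g" "integrable lebesgue w"
    and \<psi>: "\<psi> \<in> C0_infty UNIV"
  shows "curl (conv \<psi> g) X = conv \<psi> w X"
proof -
  let ?d = "\<lambda>j z. frechet_derivative \<psi> (at (z - X)) (axis j (1::real))"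
  have i: "integrable lebesgue (\<lambda>z. frechet_derivative \<psi> (at (z - X)) v *\<^sub>R g z)" for v
    by (rule integrable_C0_infty_scaleR[OF C0_infty_translate[OF C0_infty_frechet[OF open_UNIV \<psi>]] int(1)])
  have nth: "frechet_derivative (conv \<psi> g) (at X) v $ j =
      - (LINT z|lebesgue. frechet_derivative \<psi> (at (z - X)) v * g z $ j)" for v j
    using integral_bounded_linear[OF bounded_linear_vec_nth[of j] i]
    by (simp add: frechet_conv[OF \<psi> int(1)])
  have i': "integrable lebesgue (\<lambda>z. frechet_derivative \<psi> (at (z - X)) v * g z $ j)" for v j
    using integrable_bounded_linear[OF bounded_linear_vec_nth[of j] i] by simp
  have fr: "frechet_derivative (\<lambda>z. \<psi> (z - X) *\<^sub>R c) (at z) v = frechet_derivative \<psi> (at (z - X)) v *\<^sub>R c"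
    for c :: "real^3" and z v
  proof -
    have "((\<lambda>z. \<psi> (z - X)) has_derivative frechet_derivative \<psi> (at (z - X))) (at z)"
      using smooth_on_has_derivative[OF C0_inftyD[OF C0_infty_translate[OF \<psi>, of X]], of z]
        frechet_derivative_translate[of \<psi> z X] smooth_on_differentiable[OF C0_inftyD[OF \<psi>]]
      by simp
    from frechet_derivative_at[OF bounded_linear.has_derivative[OF bounded_linear_scaleR_left this, of c]]
    show ?thesis by (simp add: fun_eq_iff)
  qed
  have test: "(LINT z|lebesgue. g z \<bullet> curl (\<lambda>z. \<psi> (z - X) *\<^sub>R axis k (1::real)) z) = conv \<psi> w X $ k" for k
  proof -
    have "(LINT z|lebesgue. g z \<bullet> curl (\<lambda>z. \<psi> (z - X) *\<^sub>R axis k (1::real)) z) =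
        (LINT z|lebesgue. w z \<bullet> (\<psi> (z - X) *\<^sub>R axis k (1::real)))"
      using bspec[OF conjunct2[OF conjunct2[OF w[unfolded weak_curl_def]]]
          C0_infty_scaleR[OF open_UNIV C0_infty_translate[OF \<psi>, of X], of "axis k 1"]]
      by (simp add: set_lebesgue_integral_def)
    also have "\<dots> = (LINT z|lebesgue. (\<psi> (z - X) *\<^sub>R w z) $ k)"
      by (simp add: inner_axis mult.commute)
    also have "\<dots> = conv \<psi> w X $ k"
      unfolding conv_def
      by (rule integral_bounded_linear[OF bounded_linear_vec_nth
            integrable_C0_infty_scaleR[OF C0_infty_translate[OF \<psi>] int(2)]])
    finally show ?thesis .
  qed
  have diff: "(LINT z|lebesgue. ?d j z * g z $ a - ?d l z * g z $ b) =
      frechet_derivative (conv \<psi> g) (at X) (axis l 1) $ b - frechet_derivative (conv \<psi> g) (at X) (axis j 1) $ a"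
    for j l a b
    by (simp add: Bochner_Integration.integral_diff[OF i' i'] nth)
  have curl_test: "g z \<bullet> curl (\<lambda>z. \<psi> (z - X) *\<^sub>R axis 1 (1::real)) z = ?d 3 z * g z $ 2 - ?d 2 z * g z $ 3"
    "g z \<bullet> curl (\<lambda>z. \<psi> (z - X) *\<^sub>R axis 2 (1::real)) z = ?d 1 z * g z $ 3 - ?d 3 z * g z $ 1"
    "g z \<bullet> curl (\<lambda>z. \<psi> (z - X) *\<^sub>R axis 3 (1::real)) z = ?d 2 z * g z $ 1 - ?d 1 z * g z $ 2" for z
    by (simp_all add: inner_vec_def sum_3 curl_nth fr axis_def)
  show ?thesis
    unfolding vec_eq_iff forall_3
    using test[of 1] test[of 2] test[of 3]
    by (simp add: curl_test diff curl_nth)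
qed

subsection \<open>The scaled mollifier\<close>

lemma lebesgue_integral_affine:
  fixes f :: "'a::euclidean_space \<Rightarrow> 'b::euclidean_space" and c :: real
  assumes "c > 0" and f: "f \<in> borel_measurable lebesgue"
  shows "(LINT z|lebesgue. f z) = c ^ DIM('a) *\<^sub>R (LINT y|lebesgue. f (t + c *\<^sub>R y))"
proof -
  have T: "(\<lambda>x. t + (\<Sum>j\<in>Basis. (c * (x \<bullet> j)) *\<^sub>R j)) = (\<lambda>y::'a. t + c *\<^sub>R y)"
    by (simp add: fun_eq_iff scaleR_scaleR[symmetric] scaleR_sum_right[symmetric] euclidean_representation
        del: scaleR_scaleR)
  have m: "(\<lambda>y. t + c *\<^sub>R y) \<in> lebesgue \<rightarrow>\<^sub>M lebesgue"
    using lebesgue_affine_measurable[of "\<lambda>_. c" t] assms(1) by (simp add: T)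
  have "lebesgue = density (distr lebesgue lebesgue (\<lambda>y. t + c *\<^sub>R y)) (\<lambda>_. ennreal (c ^ DIM('a)))"
    using lebesgue_affine_euclidean[of "\<lambda>_. c" t] assms(1) by (simp add: T)
  then have "(LINT z|lebesgue. f z) =
      (LINT z|density (distr lebesgue lebesgue (\<lambda>y. t + c *\<^sub>R y)) (\<lambda>_. ennreal (c ^ DIM('a))). f z)"
    by simp
  also have "\<dots> = (LINT z|distr lebesgue lebesgue (\<lambda>y. t + c *\<^sub>R y). c ^ DIM('a) *\<^sub>R f z)"
    using f assms(1) by (intro integral_density) auto
  also have "\<dots> = c ^ DIM('a) *\<^sub>R (LINT y|lebesgue. f (t + c *\<^sub>R y))"
    using f m by (subst integral_distr) auto
  finally show ?thesis .
qed

definition scaled_mollifier :: "real \<Rightarrow> real \<Rightarrow> real^3 \<Rightarrow> real" where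
  "scaled_mollifier \<eta> \<epsilon> w = mollifier \<eta> (inverse \<epsilon> *\<^sub>R w) / \<epsilon> ^ 3"

lemma scaled_mollifier_C0_infty:
  assumes "\<epsilon> > 0" shows "scaled_mollifier \<eta> \<epsilon> \<in> C0_infty UNIV"
proof -
  have "(\<lambda>w. (1 / \<epsilon> ^ 3) * mollifier \<eta> (inverse \<epsilon> *\<^sub>R (w - 0))) \<in> C0_infty UNIV"
    by (rule C0_infty_bounded_linear[OF open_UNIV bounded_linear_mult_right
          C0_infty_affine[OF mollifier_C0_infty]]) (use assms in simp)
  then show ?thesis by (simp add: scaled_mollifier_def[abs_def])
qed

text \<open>The mollifier vanishes off the unit ball, so the integral extends to the whole space;
  the cube of \<epsilon> in \<open>scaled_mollifier\<close> is the Jacobian of z = X + \<epsilon>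
  y.\<close>

lemma mollify_eq_conv:
  fixes h :: "real^3 \<Rightarrow> 'b::euclidean_space"
  assumes "\<epsilon> > 0" and h: "h \<in> borel_measurable lebesgue"
  shows "(LINT y:ball 0 1|lebesgue. mollifier \<eta> y *\<^sub>R h (X + \<epsilon> *\<^sub>R y)) = conv (scaled_mollifier \<eta> \<epsilon>) h X"
proof -
  have "(LINT y:ball 0 1|lebesgue. mollifier \<eta> y *\<^sub>R h (X + \<epsilon> *\<^sub>R y)) =
      (LINT y|lebesgue. mollifier \<eta> y *\<^sub>R h (X + \<epsilon> *\<^sub>R y))"
    unfolding set_lebesgue_integral_def
    by (rule Bochner_Integration.integral_cong) (auto simp: indicator_def mollifier_def)
  also have "\<dots> = (LINT y|lebesgue. \<epsilon> ^ 3 *\<^sub>R (scaled_mollifier \<eta> \<epsilon> (X + \<epsilon> *\<^sub>R y - X) *\<^sub>R h (X + \<epsilon> *\<^sub>R y)))"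
    using assms(1) by (simp add: scaled_mollifier_def)
  also have "\<dots> = \<epsilon> ^ DIM(real^3) *\<^sub>R (LINT y|lebesgue. scaled_mollifier \<eta> \<epsilon> (X + \<epsilon> *\<^sub>R y - X) *\<^sub>R h (X + \<epsilon> *\<^sub>R y))"
    by (subst integral_scaleR_right) simp
  also have "\<dots> = conv (scaled_mollifier \<eta> \<epsilon>) h X"
  proof -
    have "(\<lambda>z. scaled_mollifier \<eta> \<epsilon> (z - X)) \<in> borel_measurable lebesgue"
      using borel_measurable_continuous_onI[OF C0_infty_continuous[OF C0_infty_translate[OF scaled_mollifier_C0_infty[OF assms(1)]]]]
      by (intro measurable_completion) simp
    then have "(\<lambda>z. scaled_mollifier \<eta> \<epsilon> (z - X) *\<^sub>R h z) \<in> borel_measurable lebesgue"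
      using h by (rule borel_measurable_scaleR)
    from lebesgue_integral_affine[OF assms(1) this, of X] show ?thesis by (simp add: conv_def)
  qed
  finally show ?thesis .
qed

section \<open>Strongly Lipschitz boundaries and Lebesgue spaces\<close>

text \<open>Near each of its points the frontier lies in the image of a hyperplane under a graph map
  that is Lipschitz with constant 1 + L. A hyperplane is null in the ambient space, and Lipschitz
  maps between spaces of equal dimension preserve null sets.\<close>

lemma negligible_frontier_strongly_lipschitz:
  fixes S :: "'a::euclidean_space set"
  assumes "strongly_lipschitz S"
  shows "negligible (frontier S)"
  unfolding locally_negligible_alt[of "frontier S"]
proof
  fix x0 assume x0: "x0 \<in> frontier S"
  from bspec[OF conjunct2[OF assms[unfolded strongly_lipschitz_def]] x0]
  obtain N \<phi> L b c where N: "norm N = 1" and bc: "b > 0" "c > 0"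
    and lip: "L-lipschitz_on {h. h \<bullet> N = 0} \<phi>"
    and chart: "\<forall>h t. h \<bullet> N = 0 \<and> norm h < b \<and> \<bar>t\<bar> < c \<longrightarrow>
        (x0 + h + t *\<^sub>R N \<in> S \<longleftrightarrow> t > \<phi> h) \<and>
        (x0 + h + t *\<^sub>R N \<in> frontier S \<longleftrightarrow> t = \<phi> h) \<and>
        (x0 + h + t *\<^sub>R N \<notin> closure S \<longleftrightarrow> t < \<phi> h)"
    by (elim exE conjE)
  have fr: "x0 + h + t *\<^sub>R N \<in> frontier S \<longleftrightarrow> t = \<phi> h"
    if "h \<bullet> N = 0" "norm h < b" "\<bar>t\<bar> < c" for h t
    using chart that by simp
  let ?H = "{h. h \<bullet> N = 0}"
  define F where "F h = x0 + h + \<phi> h *\<^sub>R N" for h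
  have "negligible ?H"
  proof -
    have "N \<noteq> 0" using N by auto
    then show ?thesis using negligible_hyperplane[of N 0] by (simp add: inner_commute)
  qed
  then have neg: "negligible (F ` ?H)"
  proof (rule negligible_locally_Lipschitz_image[OF order_refl])
    fix x assume x: "x \<in> ?H"
    have "norm (F y - F x) \<le> (1 + L) * norm (y - x)" if "y \<in> ?H" for y
    proof -
      have "norm (F y - F x) = norm ((y - x) + (\<phi> y - \<phi> x) *\<^sub>R N)"
        by (simp add: F_def algebra_simps)
      also have "\<dots> \<le> norm (y - x) + \<bar>\<phi> y - \<phi> x\<bar>"
        using norm_triangle_ineq[of "y - x" "(\<phi> y - \<phi> x) *\<^sub>R N"] N by simp
      also have "\<dots> \<le> (1 + L) * norm (y - x)"
        using lipschitz_onD[OF lip that x] by (simp add: dist_norm algebra_simps)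
      finally show ?thesis .
    qed
    then show "\<exists>T B. open T \<and> x \<in> T \<and> (\<forall>y\<in>?H \<inter> T. norm (F y - F x) \<le> B * norm (y - x))"
      by (intro exI[of _ UNIV] exI[of _ "1 + L"]) auto
  qed
  \<comment> \<open>\<open>p\<close> is the orthogonal projection of x - x0 to the hyperplane, so a
    frontier point x in the chart cylinder \<open>W\<close> is recovered as
    \<open>F (p x)\<close>.\<close>
  define p where "p x = (x - x0) - ((x - x0) \<bullet> N) *\<^sub>R N" for x
  define W where "W = {x. norm (p x) < b} \<inter> {x. \<bar>(x - x0) \<bullet> N\<bar> < c}"
  have "open W"
    unfolding W_def p_def by (intro open_Int open_Collect_less continuous_intros)
  have "x0 \<in> W" using bc by (simp add: W_def p_def)
  have NN: "N \<bullet> N = 1" using N by (simp add: norm_eq_1)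
  have "x \<in> F ` ?H" if x: "x \<in> frontier S \<inter> W" for x
  proof -
    have p: "p x \<bullet> N = 0" by (simp add: p_def inner_diff_left NN)
    have x_eq: "x = x0 + p x + ((x - x0) \<bullet> N) *\<^sub>R N" by (simp add: p_def)
    have "(x - x0) \<bullet> N = \<phi> (p x)"
      using fr[OF p, of "(x - x0) \<bullet> N"] x x_eq by (simp add: W_def)
    then have "x = F (p x)" using x_eq by (simp add: F_def)
    then show ?thesis using p by blast
  qed
  then have "negligible (frontier S \<inter> W)"
    using neg negligible_subset by blast
  then show "\<exists>U. openin (top_of_set (frontier S)) U \<and> x0 \<in> U \<and> negligible U"
    using \<open>open W\<close> \<open>x0 \<in> W\<close> x0 by (intro exI[of _ "frontier S \<inter> W"]) auto
qed

section \<open>Lp functions on bounded sets\<close>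

lemma integrable_lebesgue_on_iff:
  fixes f :: "'a::euclidean_space \<Rightarrow> 'b::euclidean_space"
  assumes "S \<in> sets lebesgue"
  shows "integrable (lebesgue_on S) f \<longleftrightarrow> f absolutely_integrable_on S"
  using integrable_restrict_space[of S lebesgue f] assms by (simp add: set_integrable_def)

lemma Lp_subset:
  fixes f :: "'a::euclidean_space \<Rightarrow> 'b::euclidean_space"
  assumes S: "S \<in> sets lebesgue" and f: "f \<in> Lp p UNIV"
  shows "f \<in> Lp p S"
proof -
  have m: "f \<in> borel_measurable (lebesgue_on S)"
    using f by (auto simp: Lp_def intro: measurable_restrict_space1)
  show ?thesis
  proof (cases "p = \<infinity>")
    case True
    then obtain C where "AE x in lebesgue_on UNIV. norm (f x) \<le> C"
      using f by (auto simp: Lp_def)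
    then have "AE x in lebesgue. norm (f x) \<le> C"
      by (simp add: AE_restrict_space_iff)
    then have "AE x in lebesgue_on S. norm (f x) \<le> C"
      using S by (auto simp: AE_restrict_space_iff elim!: eventually_mono)
    then show ?thesis using True m by (auto simp: Lp_def)
  next
    case False
    then have "(\<lambda>x. norm (f x) powr enn2real p) absolutely_integrable_on UNIV"
      using f integrable_lebesgue_on_iff[of UNIV "\<lambda>x. norm (f x) powr enn2real p"] by (simp add: Lp_def)
    then have "(\<lambda>x. norm (f x) powr enn2real p) absolutely_integrable_on S"
      by (rule set_integrable_subset) (use S in auto)
    then show ?thesis
      using False m integrable_lebesgue_on_iff[OF S, of "\<lambda>x. norm (f x) powr enn2real p"] by (simp add: Lp_def)
  qed
qed

lemma Lp_zero: "(\<lambda>x. 0) \<in> Lp p S"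
  by (auto simp: Lp_def)

text \<open>D has finite measure, so it suffices to bound the norm by a constant when p is infinite
  and by 1 plus its p-th power otherwise. All exponents are thereby reduced to
  integrability.\<close>

lemma Lp_integrable_ext0:
  fixes f :: "'a::euclidean_space \<Rightarrow> 'b::euclidean_space"
  assumes D: "open D" "bounded D" and f: "f \<in> Lp p D" and p: "1 \<le> p"
  shows "integrable lebesgue (ext0 D f)"
proof -
  have lm: "D \<in> lmeasurable" using D lmeasurable_open by blast
  interpret finite_measure "lebesgue_on D" by (rule finite_measure_lebesgue_on[OF lm])
  have m: "f \<in> borel_measurable (lebesgue_on D)" using f by (simp add: Lp_def)
  have "integrable (lebesgue_on D) f"
  proof (cases "p = \<infinity>")
    case True
    then obtain C where "AE x in lebesgue_on D. norm (f x) \<le> C"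
      using f by (auto simp: Lp_def)
    then show ?thesis by (rule integrable_const_bound) (rule m)
  next
    case False
    let ?q = "enn2real p"
    have q: "?q \<ge> 1" using p False enn2real_mono[of 1 p] by (simp add: top.not_eq_extremum)
    have "integrable (lebesgue_on D) (\<lambda>x. 1 + norm (f x) powr ?q)"
      using f False by (simp add: Lp_def)
    then show ?thesis
    proof (rule Bochner_Integration.integrable_bound[OF _ m])
      have "t \<le> 1 + t powr ?q" if "t \<ge> 0" for t :: real
      proof (cases "t \<le> 1")
        case False
        then have "t powr 1 \<le> t powr ?q" using q by (intro powr_mono) auto
        then show ?thesis using False by simp
      qed (simp add: add_increasing2)
      then show "AE x in lebesgue_on D. norm (f x) \<le> norm (1 + norm (f x) powr ?q)"
        by (intro AE_I2) simp
    qed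
  qed
  then have "integrable lebesgue (\<lambda>x. indicator D x *\<^sub>R f x)"
    using integrable_lebesgue_on_iff[of D f] lm by (simp add: set_integrable_def fmeasurableD)
  moreover have "(\<lambda>x. indicator D x *\<^sub>R f x) = ext0 D f"
    by (auto simp: ext0_def indicator_def)
  ultimately show ?thesis by simp
qed

section \<open>Weak derivatives and extension by zero\<close>

lemma loc_integrable_subset: "loc_integrable T f \<Longrightarrow> S \<subseteq> T \<Longrightarrow> loc_integrable S f"
  unfolding loc_integrable_def by blast

lemma loc_integrable_spike:
  assumes "loc_integrable S f" "negligible {x \<in> S. f x \<noteq> g x}"
  shows "loc_integrable S g"
  unfolding loc_integrable_def
proof safe
  fix C assume C: "compact C" "C \<subseteq> S"
  then have "f absolutely_integrable_on C" using assms(1) by (simp add: loc_integrable_def)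
  then show "g absolutely_integrable_on C"
    by (rule absolutely_integrable_spike[OF _ assms(2)]) (use C in auto)
qed

lemma loc_integrable_zero: "loc_integrable S (\<lambda>x. 0)"
  by (simp add: loc_integrable_def set_integrable_def)

lemma loc_integrable_diff:
  "loc_integrable S f \<Longrightarrow> loc_integrable S g \<Longrightarrow> loc_integrable S (\<lambda>x. f x - g x)"
  unfolding loc_integrable_def using set_integral_diff(1) by blast

lemma loc_integrable_bounded_linear:
  assumes "bounded_linear h" "loc_integrable S f" shows "loc_integrable S (\<lambda>x. h (f x))"
  unfolding loc_integrable_def set_integrable_def
proof safe
  fix C assume "compact C" "C \<subseteq> S"
  then have "integrable lebesgue (\<lambda>x. indicator C x *\<^sub>R f x)"
    using assms(2) by (simp add: loc_integrable_def set_integrable_def)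
  from integrable_bounded_linear[OF assms(1) this]
  show "integrable lebesgue (\<lambda>x. indicator C x *\<^sub>R h (f x))"
    by (simp add: linear_scale[OF bounded_linear.linear[OF assms(1)]])
qed

text \<open>The test function is bounded and supported in a compact C, and w is integrable on C;
  cutting w off to C does not change the pairing. One bilinear M covers products, scalar multiples
  and inner products alike.\<close>

lemma set_integrable_test:
  fixes M :: "'v::euclidean_space \<Rightarrow> 'w::euclidean_space \<Rightarrow> 'r::euclidean_space"
    and \<phi> :: "'a::euclidean_space \<Rightarrow> 'v"
  assumes M: "bounded_bilinear M" and S: "open S" and \<phi>: "\<phi> \<in> C0_infty S" and w: "loc_integrable S w"
  shows "(\<lambda>x. M (\<phi> x) (w x)) absolutely_integrable_on S"
proof -
  interpret M: bounded_bilinear M by (rule M)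
  obtain C where C: "compact C" "C \<subseteq> S" "\<And>x. x \<in> S - C \<Longrightarrow> \<phi> x = 0"
    using \<phi> unfolding C0_infty_def by blast
  have \<phi>': "ext0 S \<phi> \<in> C0_infty UNIV" by (rule C0_infty_ext0[OF S \<phi>])
  obtain B where B: "\<And>x. norm (ext0 S \<phi> x) \<le> B" "B > 0" using C0_infty_bounded[OF \<phi>'] by metis
  obtain K where K: "K > 0" "\<And>a b. norm (M a b) \<le> norm a * norm b * K" using M.pos_bounded by auto
  define v where "v x = indicator C x *\<^sub>R w x" for x
  have v: "integrable lebesgue v"
    using w C by (simp add: v_def[abs_def] loc_integrable_def set_integrable_def)
  have m: "ext0 S \<phi> \<in> borel_measurable lebesgue"
    using borel_measurable_continuous_onI[OF C0_infty_continuous[OF \<phi>']]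
    by (intro measurable_completion) simp
  have "integrable lebesgue (\<lambda>x. M (ext0 S \<phi> x) (v x))"
  proof (rule Bochner_Integration.integrable_bound[of _ "\<lambda>x. (B * K) *\<^sub>R v x"])
    show "integrable lebesgue (\<lambda>x. (B * K) *\<^sub>R v x)" using v by simp
    show "(\<lambda>x. M (ext0 S \<phi> x) (v x)) \<in> borel_measurable lebesgue"
      by (rule borel_measurable_continuous_Pair[OF m borel_measurable_integrable[OF v]])
        (intro M.continuous_on continuous_intros)
    show "AE x in lebesgue. norm (M (ext0 S \<phi> x) (v x)) \<le> norm ((B * K) *\<^sub>R v x)"
    proof (rule AE_I2)
      fix x
      have "norm (M (ext0 S \<phi> x) (v x)) \<le> norm (ext0 S \<phi> x) * norm (v x) * K" by (rule K)
      also have "\<dots> \<le> B * norm (v x) * K"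
        using B K by (intro mult_right_mono) auto
      finally show "norm (M (ext0 S \<phi> x) (v x)) \<le> norm ((B * K) *\<^sub>R v x)"
        using B K by (simp add: mult_ac)
    qed
  qed
  moreover have "M (ext0 S \<phi> x) (v x) = indicator S x *\<^sub>R M (\<phi> x) (w x)" for x
    using C by (cases "x \<in> S"; cases "x \<in> C") (auto simp: v_def ext0_apply M.zero_left M.zero_right)
  ultimately show ?thesis by (simp add: set_integrable_def)
qed

text \<open>The three weak derivatives are instances of one pattern, in which the classical operator \<open>A\<close>
  is applied to the test function and the pairings \<open>B\<close> and \<open>M\<close> absorb the sign.\<close>

locale weak_operator =
  fixes A :: "(real^3 \<Rightarrow> 'v::euclidean_space) \<Rightarrow> real^3 \<Rightarrow> 'u::euclidean_space"
    and B :: "'f::euclidean_space \<Rightarrow> 'u \<Rightarrow> 'r::euclidean_space"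
    and M :: "'v \<Rightarrow> 'w::euclidean_space \<Rightarrow> 'r"
  assumes bilinear_B: "bounded_bilinear B" and bilinear_M: "bounded_bilinear M"
    and A_ext0: "open S \<Longrightarrow> \<phi> \<in> C0_infty S \<Longrightarrow> A (ext0 S \<phi>) x = ext0 S (A \<phi>) x"
    and nondegenerate: "(\<And>v. M v w = 0) \<Longrightarrow> w = 0"
begin

definition weak :: "(real^3) set \<Rightarrow> (real^3 \<Rightarrow> 'f) \<Rightarrow> (real^3 \<Rightarrow> 'w) \<Rightarrow> bool" where
  "weak S F w \<longleftrightarrow> loc_integrable S F \<and> loc_integrable S w \<and>
     (\<forall>\<phi>\<in>C0_infty S. (LINT x:S|lebesgue. B (F x) (A \<phi> x)) = (LINT x:S|lebesgue. M (\<phi> x) (w x)))"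

sublocale B: bounded_bilinear B by (rule bilinear_B)
sublocale M: bounded_bilinear M by (rule bilinear_M)

text \<open>Zero extensions of test functions on S are admissible on the whole space and commute
  with the operator \<open>A\<close>.\<close>

lemma weak_restrict:
  assumes "weak UNIV F w" "open S"
  shows "weak S F w"
  unfolding weak_def
proof (intro conjI ballI)
  show "loc_integrable S F" "loc_integrable S w"
    using assms(1) loc_integrable_subset[of UNIV _ S] by (auto simp: weak_def)
  fix \<phi> :: "real^3 \<Rightarrow> 'v" assume \<phi>: "\<phi> \<in> C0_infty S"
  have "(LINT x:UNIV|lebesgue. B (F x) (A (ext0 S \<phi>) x)) = (LINT x:UNIV|lebesgue. M (ext0 S \<phi> x) (w x))"
    using assms(1) C0_infty_ext0[OF assms(2) \<phi>] by (simp add: weak_def)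
  moreover have "B (F x) (A (ext0 S \<phi>) x) = indicator S x *\<^sub>R B (F x) (A \<phi> x)" for x
    by (simp add: A_ext0[OF assms(2) \<phi>] ext0_apply B.zero_right)
  moreover have "M (ext0 S \<phi> x) (w x) = indicator S x *\<^sub>R M (\<phi> x) (w x)" for x
    by (simp add: ext0_apply M.zero_left)
  ultimately show "(LINT x:S|lebesgue. B (F x) (A \<phi> x)) = (LINT x:S|lebesgue. M (\<phi> x) (w x))"
    by (simp add: set_lebesgue_integral_def)
qed

text \<open>Test fields of the form s(x) v with v fixed reduce the claim to
  \<open>M v (w x)\<close>. By linearity finitely many basis vectors v suffice to detect a nonzero
  value.\<close>

lemma fundamental_lemma_pairing:
  fixes S :: "(real^3) set"
  assumes S: "open S" and w: "loc_integrable S w"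
    and test: "\<And>\<phi>. \<phi> \<in> C0_infty S \<Longrightarrow> (LINT x:S|lebesgue. M (\<phi> x) (w x)) = 0"
  shows "negligible {x \<in> S. w x \<noteq> 0}"
proof -
  have "negligible {x \<in> S. M v (w x) \<noteq> 0}" for v
  proof (rule fundamental_lemma[OF S loc_integrable_bounded_linear[OF M.bounded_linear_right w]])
    fix s :: "real^3 \<Rightarrow> real" assume "s \<in> C0_infty S"
    from test[OF C0_infty_scaleR[OF S this, of v]]
    show "(LINT x:S|lebesgue. s x *\<^sub>R M v (w x)) = 0" by (simp add: M.scaleR_left)
  qed
  then have "negligible (\<Union>v\<in>Basis. {x \<in> S. M v (w x) \<noteq> 0})"
    by (intro negligible_Union) auto
  moreover have "{x \<in> S. w x \<noteq> 0} \<subseteq> (\<Union>v\<in>Basis. {x \<in> S. M v (w x) \<noteq> 0})"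
  proof
    fix x assume x: "x \<in> {x \<in> S. w x \<noteq> 0}"
    then obtain v where v: "M v (w x) \<noteq> 0" using nondegenerate by blast
    have "M (\<Sum>b\<in>Basis. (v \<bullet> b) *\<^sub>R b) (w x) = (\<Sum>b\<in>Basis. (v \<bullet> b) *\<^sub>R M b (w x))"
      by (simp add: M.sum_left M.scaleR_left)
    then have "(\<Sum>b\<in>Basis. (v \<bullet> b) *\<^sub>R M b (w x)) \<noteq> 0" using v by (simp add: euclidean_representation)
    then obtain b where "b \<in> Basis" "(v \<bullet> b) *\<^sub>R M b (w x) \<noteq> 0"
      by (meson sum.neutral)
    then show "x \<in> (\<Union>v\<in>Basis. {x \<in> S. M v (w x) \<noteq> 0})" using x by auto
  qed
  ultimately show ?thesis using negligible_subset by blast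
qed

text \<open>Two functions that agree on S are allowed, so that a zero extension can be compared with
  g inside D and with 0 off the closure of D.\<close>

lemma weak_unique:
  assumes S: "open S" and w1: "weak S F w1" and w2: "weak S F' w2" and F: "\<And>x. x \<in> S \<Longrightarrow> F x = F' x"
  shows "negligible {x \<in> S. w1 x \<noteq> w2 x}"
proof -
  have "negligible {x \<in> S. w1 x - w2 x \<noteq> 0}"
  proof (rule fundamental_lemma_pairing[OF S])
    show "loc_integrable S (\<lambda>x. w1 x - w2 x)"
      using w1 w2 by (intro loc_integrable_diff) (auto simp: weak_def)
    fix \<phi> :: "real^3 \<Rightarrow> 'v" assume \<phi>: "\<phi> \<in> C0_infty S"
    have "(LINT x:S|lebesgue. B (F x) (A \<phi> x)) = (LINT x:S|lebesgue. B (F' x) (A \<phi> x))"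
      by (rule set_lebesgue_integral_cong) (use F S in auto)
    then have "(LINT x:S|lebesgue. M (\<phi> x) (w1 x)) = (LINT x:S|lebesgue. M (\<phi> x) (w2 x))"
      using w1 w2 \<phi> by (simp add: weak_def)
    moreover have "(LINT x:S|lebesgue. M (\<phi> x) (w1 x - w2 x)) =
        (LINT x:S|lebesgue. M (\<phi> x) (w1 x)) - (LINT x:S|lebesgue. M (\<phi> x) (w2 x))"
      unfolding M.diff_right
      by (rule set_integral_diff(2)) (use w1 w2 \<phi> S in \<open>auto simp: weak_def intro!: set_integrable_test[OF bilinear_M]\<close>)
    ultimately show "(LINT x:S|lebesgue. M (\<phi> x) (w1 x - w2 x)) = 0" by simp
  qed
  then show ?thesis by simp
qed

lemma weak_zero: "weak S (\<lambda>x. 0) (\<lambda>x. 0)"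
  by (simp add: weak_def loc_integrable_zero B.zero_left M.zero_right)

lemma weak_spike:
  assumes S: "open S" and w: "weak S F w" and neg: "negligible {x \<in> S. w x \<noteq> w' x}"
  shows "weak S F w'"
  unfolding weak_def
proof (intro conjI ballI)
  show F: "loc_integrable S F" and w': "loc_integrable S w'"
    using w loc_integrable_spike[OF _ neg] by (auto simp: weak_def)
  fix \<phi> :: "real^3 \<Rightarrow> 'v" assume \<phi>: "\<phi> \<in> C0_infty S"
  have wl: "loc_integrable S w" using w by (simp add: weak_def)
  have "(LINT x:S|lebesgue. M (\<phi> x) (w x)) = integral S (\<lambda>x. M (\<phi> x) (w x))"
    by (rule set_lebesgue_integral_eq_integral(2)[OF set_integrable_test[OF bilinear_M S \<phi> wl]])
  also have "\<dots> = integral S (\<lambda>x. M (\<phi> x) (w' x))"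
    by (rule integral_spike[OF neg]) auto
  also have "\<dots> = (LINT x:S|lebesgue. M (\<phi> x) (w' x))"
    by (rule set_lebesgue_integral_eq_integral(2)[OF set_integrable_test[OF bilinear_M S \<phi> w'], symmetric])
  finally show "(LINT x:S|lebesgue. B (F x) (A \<phi> x)) = (LINT x:S|lebesgue. M (\<phi> x) (w' x))"
    using w \<phi> by (simp add: weak_def)
qed

text \<open>A weak derivative of \<open>ext0 D g\<close> is almost everywhere determined on \<open>D\<close> and vanishes outside the
  closure of \<open>D\<close>, so it is the zero extension of the weak derivative of \<open>g\<close> on \<open>D\<close> as soon as the
  boundary is a null set.\<close>

lemma weak_ext0:
  assumes D: "open D" "bounded D" "negligible (frontier D)"
    and w0: "weak UNIV (ext0 D g) w0" and w: "weak D g w"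
  shows "negligible {x. w0 x \<noteq> ext0 D w x}" "weak UNIV (ext0 D g) (ext0 D w)"
    "integrable lebesgue (ext0 D w)"
proof -
  have "negligible {x \<in> D. w0 x \<noteq> w x}"
    by (rule weak_unique[OF D(1) weak_restrict[OF w0 D(1)] w]) (simp add: ext0_apply)
  moreover have "negligible {x \<in> - closure D. w0 x \<noteq> 0}"
    by (rule weak_unique[OF _ weak_restrict[OF w0] weak_zero])
      (use closure_subset in \<open>auto simp: ext0_apply\<close>)
  ultimately have "negligible ({x \<in> D. w0 x \<noteq> w x} \<union> {x \<in> - closure D. w0 x \<noteq> 0} \<union> frontier D)"
    using D(3) by (intro negligible_Un)
  then show neg: "negligible {x. w0 x \<noteq> ext0 D w x}"
    by (rule negligible_subset)
      (use D(1) in \<open>auto simp: ext0_apply frontier_def interior_open split: if_splits\<close>)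
  show wext: "weak UNIV (ext0 D g) (ext0 D w)"
    by (rule weak_spike[OF open_UNIV w0]) (use neg in simp)
  \<comment> \<open>The closure of the bounded set D is compact, so local integrability on the whole
    space already yields integrability there.\<close>
  have "ext0 D w absolutely_integrable_on closure D"
    using wext D(2) by (simp add: weak_def loc_integrable_def)
  moreover have "(\<lambda>x. indicator (closure D) x *\<^sub>R ext0 D w x) = ext0 D w"
    using closure_subset[of D] by (intro ext) (auto simp: ext0_apply indicator_def)
  ultimately show "integrable lebesgue (ext0 D w)" by (simp add: set_integrable_def)
qed

text \<open>Existence counterpart: the restriction of a global derivative is a derivative on D, and
  its zero extension is again a global one. This allows the next operator of the source row to be
  applied.\<close>

lemma weak_ext0_Lp:
  assumes D: "open D" "bounded D" "negligible (frontier D)"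
    and w0: "w0 \<in> Lp p UNIV" "weak UNIV (ext0 D g) w0"
  shows "w0 \<in> Lp p D" "weak D g w0" "weak UNIV (ext0 D g) (ext0 D w0)"
proof -
  show "w0 \<in> Lp p D" by (rule Lp_subset[OF _ w0(1)]) (use D(1) in auto)
  have r: "weak D (ext0 D g) w0" by (rule weak_restrict[OF w0(2) D(1)])
  have l: "loc_integrable D g"
  proof (rule loc_integrable_spike)
    show "loc_integrable D (ext0 D g)" using r by (simp add: weak_def)
    show "negligible {x \<in> D. ext0 D g x \<noteq> g x}" by (simp add: ext0_apply)
  qed
  have "(LINT x:D|lebesgue. B (ext0 D g x) (A \<phi> x)) = (LINT x:D|lebesgue. B (g x) (A \<phi> x))" for \<phi>
    by (rule set_lebesgue_integral_cong) (use D(1) in \<open>auto simp: ext0_apply\<close>)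
  then show wd: "weak D g w0" using r l by (simp add: weak_def)
  show "weak UNIV (ext0 D g) (ext0 D w0)" by (rule weak_ext0(2)[OF D w0(2) wd])
qed

end

section \<open>The instances for gradient, curl and divergence\<close>

lemma bounded_bilinear_minus:
  "bounded_bilinear h \<Longrightarrow> bounded_bilinear (\<lambda>a b. - h a b)"
  unfolding bounded_bilinear_def by simp

lemma weak_operator_grad: "weak_operator grad (*\<^sub>R) (\<lambda>\<phi> G. - (\<phi> *\<^sub>R G :: real^3))"
proof (rule weak_operator.intro)
  show "w = 0" if "\<And>v::real. - (v *\<^sub>R w) = 0" for w :: "real^3"
    using that[of 1] by simp
qed (rule bounded_bilinear_scaleR bounded_bilinear_minus grad_ext0; assumption?)+

lemma weak_operator_curl: "weak_operator curl (\<bullet>) (\<lambda>\<phi> w. w \<bullet> \<phi>)"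
proof (rule weak_operator.intro)
  show "w = 0" if "\<And>v. w \<bullet> v = 0" for w :: "real^3"
    using that[of w] by simp
qed (rule bounded_bilinear_inner bounded_bilinear.flip[OF bounded_bilinear_inner] curl_ext0; assumption?)+

lemma weak_operator_div: "weak_operator grad (\<bullet>) (\<lambda>\<phi> w. - (w * \<phi> :: real))"
proof (rule weak_operator.intro)
  show "w = 0" if "\<And>v. - (w * v) = 0" for w :: real
    using that[of 1] by simp
qed (rule bounded_bilinear_inner bounded_bilinear_minus bounded_bilinear.flip[OF bounded_bilinear_mult] grad_ext0;
    assumption?)+

interpretation wgrad: weak_operator grad "(*\<^sub>R)" "\<lambda>\<phi> G. - (\<phi> *\<^sub>R G :: real^3)"
  by (rule weak_operator_grad)

interpretation wcurl: weak_operator curl "(\<bullet>)" "\<lambda>\<phi> w. w \<bullet> \<phi>"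
  by (rule weak_operator_curl)

interpretation wdiv: weak_operator grad "(\<bullet>)" "\<lambda>\<phi> w. - (w * \<phi> :: real)"
  by (rule weak_operator_div)

lemma weak_grad_iff: "weak_grad = wgrad.weak"
  by (intro ext) (simp add: weak_grad_def wgrad.weak_def set_lebesgue_integral_def)

lemma weak_curl_iff: "weak_curl = wcurl.weak"
  by (intro ext) (simp add: weak_curl_def wcurl.weak_def)

lemma weak_div_iff: "weak_div = wdiv.weak"
  by (intro ext) (simp add: weak_div_def wdiv.weak_def set_lebesgue_integral_def)

text \<open>By duality this rests on div curl = 0 for test fields. Every component of curl \<phi> is
  a scalar test function for the weak gradient; summing the matching components turns the pairing of
  G with curl \<phi> into minus the integral of f div curl \<phi>.\<close>

lemma weak_grad_imp_weak_curl_0: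
  assumes S: "open S" and w: "weak_grad S f G"
  shows "weak_curl S G (\<lambda>x. 0)"
  unfolding weak_curl_def
proof (intro conjI ballI)
  show "loc_integrable S G" using w by (simp add: weak_grad_def)
  show "loc_integrable S (\<lambda>x. 0)" by (rule loc_integrable_zero)
  have f: "loc_integrable S f" and G: "loc_integrable S G" using w by (auto simp: weak_grad_def)
  fix \<phi> :: "real^3 \<Rightarrow> real^3" assume \<phi>: "\<phi> \<in> C0_infty S"
  let ?c = "\<lambda>i x. curl \<phi> x $ i"
  have c: "?c i \<in> C0_infty S" for i by (rule C0_infty_nth[OF S C0_infty_curl[OF S \<phi>]])
  have iG: "(\<lambda>x. ?c i x *\<^sub>R G x) absolutely_integrable_on S" for i
    by (rule set_integrable_test[OF bounded_bilinear_scaleR S c G])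
  have igf: "(\<lambda>x. f x *\<^sub>R grad (?c i) x) absolutely_integrable_on S" for i
    using set_integrable_test[OF bounded_bilinear.flip[OF bounded_bilinear_scaleR] S C0_infty_grad[OF S c] f] .
  have nth: "(LINT x:S|lebesgue. h x $ i) = (LINT x:S|lebesgue. h x) $ i"
      "(\<lambda>x. h x $ i) absolutely_integrable_on S"
    if "h absolutely_integrable_on S" for h :: "real^3 \<Rightarrow> real^3" and i
    using integral_bounded_linear[OF bounded_linear_vec_nth[of i] that[unfolded set_integrable_def]]
      integrable_bounded_linear[OF bounded_linear_vec_nth[of i] that[unfolded set_integrable_def]]
    by (simp_all add: set_lebesgue_integral_def set_integrable_def)
  have sum: "(LINT x:S|lebesgue. \<Sum>i\<in>UNIV. h i x) = (\<Sum>i\<in>UNIV. LINT x:S|lebesgue. h i x)"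
    if "\<And>i. h i absolutely_integrable_on S" for h :: "3 \<Rightarrow> real^3 \<Rightarrow> real"
    unfolding set_lebesgue_integral_def scaleR_sum_right
    by (rule Bochner_Integration.integral_sum[OF that[unfolded set_integrable_def]])
  have "(LINT x:S|lebesgue. G x \<bullet> curl \<phi> x) = (LINT x:S|lebesgue. \<Sum>i\<in>UNIV. (?c i x *\<^sub>R G x) $ i)"
    by (simp add: inner_vec_def mult.commute)
  also have "\<dots> = (\<Sum>i\<in>UNIV. LINT x:S|lebesgue. (?c i x *\<^sub>R G x) $ i)"
    by (rule sum[OF nth(2)[OF iG]])
  also have "\<dots> = (\<Sum>i\<in>UNIV. (LINT x:S|lebesgue. ?c i x *\<^sub>R G x) $ i)"
    by (simp only: nth(1)[OF iG])
  also have "\<dots> = (\<Sum>i\<in>UNIV. - (LINT x:S|lebesgue. f x *\<^sub>R grad (?c i) x) $ i)"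
    using w c by (simp add: weak_grad_def)
  also have "\<dots> = - (\<Sum>i\<in>UNIV. LINT x:S|lebesgue. (f x *\<^sub>R grad (?c i) x) $ i)"
    by (simp only: nth(1)[OF igf] sum_negf)
  also have "\<dots> = - (LINT x:S|lebesgue. \<Sum>i\<in>UNIV. (f x *\<^sub>R grad (?c i) x) $ i)"
    by (simp only: sum[OF nth(2)[OF igf]])
  also have "(LINT x:S|lebesgue. \<Sum>i\<in>UNIV. (f x *\<^sub>R grad (?c i) x) $ i) = (LINT x:S|lebesgue. 0)"
  proof (rule set_lebesgue_integral_cong)
    have sm: "smooth_on S \<phi>" by (rule C0_inftyD[OF \<phi>])
    have "(\<Sum>i\<in>UNIV. (f x *\<^sub>R grad (?c i) x) $ i) = f x * divergence (curl \<phi>) x" if "x \<in> S" for x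
      using frechet_derivative_nth[OF smooth_on_differentiable[OF smooth_on_curl[OF S sm] that]]
      by (simp add: divergence_def jacobian_nth grad_nth sum_distrib_left)
    then show "\<forall>x. x \<in> S \<longrightarrow> (\<Sum>i\<in>UNIV. (f x *\<^sub>R grad (?c i) x) $ i) = 0"
      using div_curl[OF S _ sm] by simp
  qed (use S in auto)
  finally show "(LINT x:S|lebesgue. G x \<bullet> curl \<phi> x) = (LINT x:S|lebesgue. 0 \<bullet> \<phi> x)"
    by simp
qed

text \<open>Here grad \<phi> is itself a test field for the weak curl, so the dual identity curl
  grad = 0 finishes the proof.\<close>

lemma weak_curl_imp_weak_div_0:
  assumes S: "open S" and w: "weak_curl S g w"
  shows "weak_div S w (\<lambda>x. 0)"
  unfolding weak_div_def
proof (intro conjI ballI)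
  show "loc_integrable S w" using w by (simp add: weak_curl_def)
  show "loc_integrable S (\<lambda>x. 0)" by (rule loc_integrable_zero)
  fix \<phi> :: "real^3 \<Rightarrow> real" assume \<phi>: "\<phi> \<in> C0_infty S"
  have "(LINT x:S|lebesgue. w x \<bullet> grad \<phi> x) = (LINT x:S|lebesgue. g x \<bullet> curl (grad \<phi>) x)"
    using w C0_infty_grad[OF S \<phi>] by (simp add: weak_curl_def)
  also have "\<dots> = (LINT x:S|lebesgue. 0)"
    by (rule set_lebesgue_integral_cong) (use S curl_grad[OF S _ C0_inftyD[OF \<phi>]] in auto)
  finally show "(LINT x:S|lebesgue. w x \<bullet> grad \<phi> x) = - (LINT x:S|lebesgue. 0 * \<phi> x)" by simp
qed

section \<open>The mollification operators\<close>

text \<open>Boundary points are limits of points of \<open>Om\<close>, whose images lie well inside \<open>Om\<close>. So from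
  a point of \<open>D\<close> close to the boundary the operators only see values of the zero extension
  outside \<open>D\<close>.\<close>

lemma shrink_compact_support:
  fixes D Om :: "'a::euclidean_space set"
  assumes D: "open D" "bounded D" and Om: "Om \<inter> closure D = {}" "frontier D \<subseteq> closure Om"
    and \<theta>: "continuous_on UNIV \<theta>" and \<epsilon>: "\<epsilon> > 0" "\<And>u. u \<in> Om \<Longrightarrow> ball (\<theta> u) (3 * \<epsilon>) \<subseteq> Om"
  obtains C where "compact C" "C \<subseteq> D" "\<And>x y. x \<in> D - C \<Longrightarrow> norm y \<le> 1 \<Longrightarrow> \<theta> x + \<epsilon> *\<^sub>R y \<notin> D"
proof
  \<comment> \<open>Pairs of a point and an averaging direction whose sample lands in the closure of
    D. They form a compact set, and its projection to the first factor is the required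
    support.\<close>
  define P where "P = (closure D \<times> cball 0 1) \<inter> {z. \<theta> (fst z) + \<epsilon> *\<^sub>R snd z \<in> closure D}"
  have "continuous_on UNIV (\<lambda>z::'a \<times> 'a. \<theta> (fst z) + \<epsilon> *\<^sub>R snd z)"
    by (intro continuous_intros continuous_on_compose2[OF \<theta>]) auto
  from continuous_closed_vimage[OF closed_closure, of _ D] this
  have "closed {z. \<theta> (fst z) + \<epsilon> *\<^sub>R snd z \<in> closure D}"
    using continuous_on_closed_vimage[of "UNIV :: ('a \<times> 'a) set" "\<lambda>z. \<theta> (fst z) + \<epsilon> *\<^sub>R snd z"]
    by (auto simp: vimage_def)
  then have "compact P"
    unfolding P_def using D(2) by (intro compact_Int_closed compact_Times) auto
  then show "compact (fst ` P)"
    by (intro compact_continuous_image continuous_intros)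
  have bd: "\<theta> x + \<epsilon> *\<^sub>R y \<notin> closure D" if x: "x \<in> frontier D" and y: "norm y \<le> 1" for x y
  proof -
    obtain u where u: "\<And>n. u n \<in> Om" "u \<longlonglongrightarrow> x"
      using x Om(2) closure_sequential[of x Om] by blast
    have "(\<lambda>n. \<theta> (u n)) \<longlonglongrightarrow> \<theta> x"
      using continuous_on_tendsto_compose[OF \<theta> u(2)] by simp
    then have "\<forall>\<^sub>F n in sequentially. dist (\<theta> (u n)) (\<theta> x) < \<epsilon>"
      using \<epsilon>(1) tendstoD by blast
    then obtain n where n: "dist (\<theta> (u n)) (\<theta> x) < \<epsilon>"
      using eventually_happens'[OF sequentially_bot] by blast
    have "dist (\<theta> (u n)) (\<theta> x + \<epsilon> *\<^sub>R y) \<le> dist (\<theta> (u n)) (\<theta> x) + dist (\<theta> x) (\<theta> x + \<epsilon> *\<^sub>R y)"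
      by (rule dist_triangle)
    also have "dist (\<theta> x) (\<theta> x + \<epsilon> *\<^sub>R y) \<le> \<epsilon>"
      using \<epsilon>(1) y by (simp add: dist_norm mult_left_le)
    \<comment> \<open>Less than \<epsilon> from the approximation plus at most \<epsilon> from y
      gives less than 2 \<epsilon>, within the radius 3 \<epsilon>.\<close>
    finally have "\<theta> x + \<epsilon> *\<^sub>R y \<in> ball (\<theta> (u n)) (3 * \<epsilon>)"
      using n \<epsilon>(1) by simp
    then have "\<theta> x + \<epsilon> *\<^sub>R y \<in> Om" using \<epsilon>(2)[OF u(1)] by blast
    then show ?thesis using Om(1) by blast
  qed
  show "fst ` P \<subseteq> D"
  proof
    fix x assume "x \<in> fst ` P"
    then obtain y where y: "x \<in> closure D" "norm y \<le> 1" "\<theta> x + \<epsilon> *\<^sub>R y \<in> closure D"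
      by (auto simp: P_def)
    then have "x \<notin> frontier D" using bd by blast
    then show "x \<in> D" using y(1) D(1) by (simp add: frontier_def interior_open)
  qed
  show "\<theta> x + \<epsilon> *\<^sub>R y \<notin> D" if x: "x \<in> D - fst ` P" and y: "norm y \<le> 1" for x y
  proof
    assume "\<theta> x + \<epsilon> *\<^sub>R y \<in> D"
    then have "(x, y) \<in> P"
      using x y closure_subset[of D] by (auto simp: P_def)
    then show False using x by force
  qed
qed

text \<open>The Jacobian weights depend on x but not on the integration variable y, so each acts as
  a fixed linear map and leaves the integral.\<close>

lemma mollify_linear:
  fixes F :: "real^3 \<Rightarrow> 'b::euclidean_space" and h :: "'b \<Rightarrow> 'c::euclidean_space"
  assumes "\<epsilon> > 0" "bounded_linear h" "integrable lebesgue F"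
  shows "(LINT y:ball 0 1|lebesgue. mollifier \<eta> y *\<^sub>R h (F (X + \<epsilon> *\<^sub>R y))) = h (conv (scaled_mollifier \<eta> \<epsilon>) F X)"
  using mollify_eq_conv[OF assms(1) borel_measurable_integrable[OF integrable_bounded_linear[OF assms(2,3)]]]
    conv_bounded_linear[OF assms(2) scaled_mollifier_C0_infty[OF assms(1)] assms(3)]
  by simp

lemma smooth_on_shrink: "smooth_on UNIV k \<Longrightarrow> smooth_on UNIV (shrink k \<delta>)"
  unfolding shrink_def[abs_def]
  by (rule smooth_on_add[OF open_UNIV smooth_on_ident[OF open_UNIV]
        smooth_on_bounded_linear[OF open_UNIV bounded_linear_scaleR_right]])

lemma smooth_on_matrix_vector_mult:
  fixes A :: "'a::real_normed_vector \<Rightarrow> real^'n^'m" and V :: "'a \<Rightarrow> real^'n"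
  assumes "open S" "\<And>i j. smooth_on S (\<lambda>x. A x $ i $ j)" "smooth_on S V"
  shows "smooth_on S (\<lambda>x. A x *v V x)"
proof (rule smooth_on_componentwise[OF assms(1)])
  show "smooth_on S (\<lambda>x. (A x *v V x) $ i)" for i
    unfolding matrix_vector_mult_def
    by (simp, intro smooth_on_sum[OF assms(1)] smooth_on_mult[OF assms(1)] assms(2)
        smooth_on_nth[OF assms(1,3)])
qed

lemma smooth_on_adj3:
  assumes "open S" "\<And>i j. smooth_on S (\<lambda>x. A x $ i $ j)"
  shows "smooth_on S (\<lambda>x. adj3 (A x) $ i $ j)"
proof -
  have "\<forall>i j. smooth_on S (\<lambda>x. adj3 (A x) $ i $ j)"
    unfolding forall_3 adj3_def
    by (simp, intro conjI smooth_on_diff smooth_on_mult assms)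
  then show ?thesis by blast
qed

text \<open>A vector v in the kernel of A satisfies |v| = |(A - 1) v| \<le> |v| / 2, so v =
  0.\<close>

lemma invertible_if_near_identity:
  assumes "mat_norm (A - mat 1) \<le> 1 / 2"
  shows "invertible A"
proof -
  have "v = 0" if "A *v v = 0" for v
  proof -
    have "norm ((A - mat 1) *v v) \<le> mat_norm (A - mat 1) * norm v"
      unfolding mat_norm_def by (rule onorm[OF matrix_vector_mul_bounded_linear])
    also have "\<dots> \<le> 1 / 2 * norm v" using assms by (rule mult_right_mono) simp
    finally show "v = 0" using that by (simp add: matrix_vector_mult_diff_rdistrib)
  qed
  then show ?thesis
    unfolding invertible_left_inverse matrix_left_invertible_ker by blast
qed

text \<open>Weak derivatives are relations, so each commutation identity is asserted for every weak
  derivative of the datum, and separate clauses provide one in the next space. The smoothed side is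
  classical, hence the identities hold at every point of D.\<close>

theorem lemma4p3:
  fixes D Om :: "(real^3) set" and xD :: "real^3" and k :: "real^3 \<Rightarrow> real^3"
    and rD \<zeta> \<delta>0 \<delta> \<eta> :: real and p :: ennreal
  assumes D: "open D" "bounded D" "connected D" "strongly_lipschitz D"
    and Om: "rD > 0" "D \<subseteq> ball xD rD" "Om = ball xD rD - closure D"
      "bounded Om" "open Om" "strongly_lipschitz Om" "frontier D \<subseteq> frontier Om"
    and k: "smooth_on UNIV k" "transversal_inward Om k" "\<forall>x\<in>frontier Om. norm (k x) = 1"
    and zeta: "\<zeta> > 0"
      "\<forall>d\<in>{0..1}. {u + z | u z. u \<in> shrink k d ` Om \<and>
          z \<in> (if d = 0 then {0} else ball 0 (3 * d * \<zeta>))} \<subseteq> Om"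
    and delta0: "0 < \<delta>0" "\<delta>0 \<le> 1"
      "\<forall>d\<in>{0..\<delta>0}. \<forall>x\<in>D. mat_norm (KK k d x - mat 1) \<le> 1 / 2 \<and>
          mat_norm (matrix_inv (KK k d x)) \<le> 2 \<and> \<bar>det (matrix_inv (KK k d x))\<bar> \<le> 2 ^ 3"
    and eta: "(LINT y|lebesgue. mollifier \<eta> y) = 1"
    and p: "1 \<le> p"
    and delta: "0 < \<delta>" "\<delta> \<le> \<delta>0"
  shows
    "\<comment> \<open>commutation with gradient, curl and divergence\<close>
     (\<forall>f\<in>Zg p D. \<forall>G. weak_grad D f G \<longrightarrow>
        (\<forall>x\<in>D. grad (Kg \<eta> \<zeta> k D \<delta> f) x = Kc \<eta> \<zeta> k D \<delta> G x)) \<and>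
     (\<forall>g\<in>Zc p D. \<forall>w. weak_curl D g w \<longrightarrow>
        (\<forall>x\<in>D. curl (Kc \<eta> \<zeta> k D \<delta> g) x = Kd \<eta> \<zeta> k D \<delta> w x)) \<and>
     (\<forall>g\<in>Zd p D. \<forall>w. weak_div D g w \<longrightarrow>
        (\<forall>x\<in>D. divergence (Kd \<eta> \<zeta> k D \<delta> g) x = Kb \<eta> \<zeta> k D \<delta> w x)) \<and>
     \<comment> \<open>the source row is well defined and a complex\<close>
     (\<forall>f\<in>Zg p D. \<exists>G\<in>Zc p D. weak_grad D f G) \<and>
     (\<forall>g\<in>Zc p D. \<exists>w\<in>Zd p D. weak_curl D g w) \<and>
     (\<forall>g\<in>Zd p D. \<exists>w\<in>Lp p D. weak_div D g w) \<and>
     (\<forall>f\<in>Zg p D. \<forall>G. weak_grad D f G \<longrightarrow> weak_curl D G (\<lambda>x. 0)) \<and>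
     (\<forall>g\<in>Zc p D. \<forall>w. weak_curl D g w \<longrightarrow> weak_div D w (\<lambda>x. 0)) \<and>
     \<comment> \<open>the operators map the source row into the target row\<close>
     (\<forall>f\<in>Zg p D. Kg \<eta> \<zeta> k D \<delta> f \<in> C0_infty D) \<and>
     (\<forall>g\<in>Zc p D. Kc \<eta> \<zeta> k D \<delta> g \<in> C0_infty D) \<and>
     (\<forall>g\<in>Zd p D. Kd \<eta> \<zeta> k D \<delta> g \<in> C0_infty D) \<and>
     (\<forall>f\<in>Lp p D. Kb \<eta> \<zeta> k D \<delta> f \<in> C0_infty D) \<and>
     \<comment> \<open>the target row is well defined and a complex\<close>
     (\<forall>u\<in>C0_infty D. grad u \<in> C0_infty D) \<and>
     (\<forall>g\<in>C0_infty D. curl g \<in> C0_infty D) \<and>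
     (\<forall>g\<in>C0_infty D. divergence g \<in> C0_infty D) \<and>
     (\<forall>u\<in>C0_infty D. \<forall>x\<in>D. curl (grad u) x = 0) \<and>
     (\<forall>g\<in>C0_infty D. \<forall>x\<in>D. divergence (curl g) x = 0)"
proof -
  let ?\<theta> = "shrink k \<delta>" and ?\<epsilon> = "\<delta> * \<zeta>"
  let ?\<psi> = "scaled_mollifier \<eta> ?\<epsilon>"
  have \<epsilon>: "?\<epsilon> > 0" using delta zeta by simp
  have \<psi>: "?\<psi> \<in> C0_infty UNIV" by (rule scaled_mollifier_C0_infty[OF \<epsilon>])
  have \<theta>: "smooth_on UNIV ?\<theta>" by (rule smooth_on_shrink[OF k(1)])
  have J: "smooth_on S (\<lambda>x. KK k \<delta> x $ i $ j)" for S i j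
    unfolding KK_def jacobian_nth
    by (rule smooth_on_subset[OF smooth_on_nth[OF open_UNIV smooth_on_frechet[OF \<theta>]] subset_UNIV])
  have neg: "negligible (frontier D)"
    by (rule negligible_frontier_strongly_lipschitz[OF D(4)])
  have inv: "invertible (KK k \<delta> x)" if "x \<in> D" for x
    using delta0(3) delta that by (intro invertible_if_near_identity) auto
  have int: "integrable lebesgue (ext0 D f)" if "f \<in> Lp p D" for f :: "real^3 \<Rightarrow> 'b::euclidean_space"
    by (rule Lp_integrable_ext0[OF D(1,2) that p])

  have Kg: "Kg \<eta> \<zeta> k D \<delta> f x = conv ?\<psi> (ext0 D f) (?\<theta> x)" if "integrable lebesgue (ext0 D f)" for f x
    unfolding Kg_def using mollify_linear[OF \<epsilon> bounded_linear_ident that, of \<eta> "?\<theta> x"] by simp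
  have Kc: "Kc \<eta> \<zeta> k D \<delta> g x = transpose (KK k \<delta> x) *v conv ?\<psi> (ext0 D g) (?\<theta> x)"
    if "integrable lebesgue (ext0 D g)" for g x
    unfolding Kc_def by (rule mollify_linear[OF \<epsilon> matrix_vector_mul_bounded_linear that])
  \<comment> \<open>Unlike the other three formulas this one is stated on D only, where the bound on
    the Jacobian guarantees its invertibility.\<close>
  have Kd: "Kd \<eta> \<zeta> k D \<delta> g x = adj3 (KK k \<delta> x) *v conv ?\<psi> (ext0 D g) (?\<theta> x)"
    if "integrable lebesgue (ext0 D g)" "x \<in> D" for g x
    unfolding Kd_def det_matrix_inv_mult[OF inv[OF that(2)]]
    by (rule mollify_linear[OF \<epsilon> matrix_vector_mul_bounded_linear that(1)])
  have Kb: "Kb \<eta> \<zeta> k D \<delta> f x = det (KK k \<delta> x) * conv ?\<psi> (ext0 D f) (?\<theta> x)"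
    if "integrable lebesgue (ext0 D f)" for f x
    unfolding Kb_def using mollify_linear[OF \<epsilon> bounded_linear_mult_right[of "det (KK k \<delta> x)"] that, of \<eta> "?\<theta> x"]
    by simp

  have smooth: "smooth_on D (\<lambda>x. conv ?\<psi> F (?\<theta> x))" if "integrable lebesgue F"
    for F :: "real^3 \<Rightarrow> 'b::euclidean_space"
    by (rule smooth_on_compose[OF D(1) smooth_on_subset[OF \<theta> subset_UNIV] smooth_on_conv[OF \<psi> that] subset_UNIV])
  have dconv: "conv ?\<psi> F differentiable (at X)" if "integrable lebesgue F"
    for F :: "real^3 \<Rightarrow> 'b::euclidean_space" and X
    by (rule smooth_on_differentiable[OF smooth_on_conv[OF \<psi> that]]) simp

  obtain C where C: "compact C" "C \<subseteq> D"
    "\<And>x y. x \<in> D - C \<Longrightarrow> norm y \<le> 1 \<Longrightarrow> ?\<theta> x + ?\<epsilon> *\<^sub>R y \<notin> D"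
  proof (rule shrink_compact_support[OF D(1,2), of Om ?\<theta> ?\<epsilon>])
    show "Om \<inter> closure D = {}" using Om(3) by blast
    show "frontier D \<subseteq> closure Om" using Om(7) by (auto simp: frontier_def)
    show "continuous_on UNIV ?\<theta>" by (rule smooth_on_continuous[OF \<theta>])
    \<comment> \<open>The standing inclusion at d = \<delta>, where \<delta> > 0 selects the ball in
      its case distinction.\<close>
    show "ball (?\<theta> u) (3 * ?\<epsilon>) \<subseteq> Om" if u: "u \<in> Om" for u
    proof
      fix w assume w: "w \<in> ball (?\<theta> u) (3 * ?\<epsilon>)"
      have "w - ?\<theta> u \<in> ball 0 (3 * \<delta> * \<zeta>)" using w by (simp add: dist_norm norm_minus_commute mult.assoc)
      moreover have "w = ?\<theta> u + (w - ?\<theta> u)" by simp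
      ultimately have "w \<in> {u + z | u z. u \<in> ?\<theta> ` Om \<and> z \<in> (if \<delta> = 0 then {0} else ball 0 (3 * \<delta> * \<zeta>))}"
        using u delta(1) by (intro CollectI exI[of _ "?\<theta> u"] exI[of _ "w - ?\<theta> u"]) auto
      moreover have "\<delta> \<in> {0..1}" using delta delta0 by simp
      ultimately show "w \<in> Om" using zeta(2) by blast
    qed
  qed (use \<epsilon> that in auto)
  \<comment> \<open>The convolution is read backwards as an average over the unit ball; for x in D -
    C every sample lies outside D, where the extension is zero.\<close>
  have vanish: "conv ?\<psi> (ext0 D F) (?\<theta> x) = 0" if F: "integrable lebesgue (ext0 D F)" and x: "x \<in> D - C"
    for F :: "real^3 \<Rightarrow> 'b::euclidean_space" and x
  proof -
    have "ext0 D F (?\<theta> x + ?\<epsilon> *\<^sub>R y) = 0" if "y \<in> ball 0 1" for y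
      using C(3)[OF x, of y] that by (simp add: ext0_apply)
    then have "(LINT y:ball 0 1|lebesgue. mollifier \<eta> y *\<^sub>R ext0 D F (?\<theta> x + ?\<epsilon> *\<^sub>R y)) = (LINT y:ball (0::real^3) 1|lebesgue. 0)"
      by (intro set_lebesgue_integral_cong) auto
    then show ?thesis using mollify_linear[OF \<epsilon> bounded_linear_ident F, of \<eta> "?\<theta> x"] by simp
  qed

  have Zg_D: "f \<in> Lp p D" "\<exists>G\<in>Lp p UNIV. wgrad.weak UNIV (ext0 D f) G" if "f \<in> Zg p D" for f
    using that by (auto simp: Zg_def weak_grad_iff)
  have Zc_D: "g \<in> Lp p D" "\<exists>w\<in>Lp p UNIV. wcurl.weak UNIV (ext0 D g) w" if "g \<in> Zc p D" for g
    using that by (auto simp: Zc_def weak_curl_iff)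
  have Zd_D: "g \<in> Lp p D" "\<exists>w\<in>Lp p UNIV. wdiv.weak UNIV (ext0 D g) w" if "g \<in> Zd p D" for g
    using that by (auto simp: Zd_def weak_div_iff)

  show ?thesis
  proof (intro conjI ballI allI impI)
    fix f G x assume f: "f \<in> Zg p D" and G: "weak_grad D f G" and x: "x \<in> D"
    obtain G0 where "wgrad.weak UNIV (ext0 D f) G0" using Zg_D(2)[OF f] by blast
    \<comment> \<open>The global derivative supplied by \<open>Zg\<close> certifies that the zero
      extension of the given \<open>G\<close> is itself integrable and a global weak
      gradient.\<close>
    note ext = wgrad.weak_ext0[OF D(1,2) neg this G[unfolded weak_grad_iff]]
    note f' = int[OF Zg_D(1)[OF f]]
    have "grad (Kg \<eta> \<zeta> k D \<delta> f) x = grad (\<lambda>x. conv ?\<psi> (ext0 D f) (?\<theta> x)) x"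
      by (simp add: Kg[OF f', abs_def])
    also have "\<dots> = transpose (KK k \<delta> x) *v grad (conv ?\<psi> (ext0 D f)) (?\<theta> x)"
      unfolding KK_def by (rule grad_pullback[OF smooth_on_differentiable[OF \<theta> UNIV_I] dconv[OF f']])
    also have "\<dots> = Kc \<eta> \<zeta> k D \<delta> G x"
      by (simp add: Kc[OF ext(3)] grad_conv[OF ext(2)[folded weak_grad_iff] f' ext(3) \<psi>])
    finally show "grad (Kg \<eta> \<zeta> k D \<delta> f) x = Kc \<eta> \<zeta> k D \<delta> G x" .
  next
    fix g w x assume g: "g \<in> Zc p D" and w: "weak_curl D g w" and x: "x \<in> D"
    obtain w0 where "wcurl.weak UNIV (ext0 D g) w0" using Zc_D(2)[OF g] by blast
    note ext = wcurl.weak_ext0[OF D(1,2) neg this w[unfolded weak_curl_iff]]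
    note g' = int[OF Zc_D(1)[OF g]]
    have "curl (Kc \<eta> \<zeta> k D \<delta> g) x = curl (\<lambda>x. transpose (KK k \<delta> x) *v conv ?\<psi> (ext0 D g) (?\<theta> x)) x"
      by (simp add: Kc[OF g', abs_def])
    also have "\<dots> = adj3 (KK k \<delta> x) *v curl (conv ?\<psi> (ext0 D g)) (?\<theta> x)"
      unfolding KK_def by (rule curl_pullback[OF open_UNIV UNIV_I \<theta> dconv[OF g']])
    also have "\<dots> = Kd \<eta> \<zeta> k D \<delta> w x"
      by (simp add: Kd[OF ext(3) x] curl_conv[OF ext(2)[folded weak_curl_iff] g' ext(3) \<psi>])
    finally show "curl (Kc \<eta> \<zeta> k D \<delta> g) x = Kd \<eta> \<zeta> k D \<delta> w x" .
  next
    fix g w x assume g: "g \<in> Zd p D" and w: "weak_div D g w" and x: "x \<in> D"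
    obtain w0 where "wdiv.weak UNIV (ext0 D g) w0" using Zd_D(2)[OF g] by blast
    note ext = wdiv.weak_ext0[OF D(1,2) neg this w[unfolded weak_div_iff]]
    note g' = int[OF Zd_D(1)[OF g]]
    let ?h = "\<lambda>x. adj3 (KK k \<delta> x) *v conv ?\<psi> (ext0 D g) (?\<theta> x)"
    have "smooth_on D ?h"
      by (rule smooth_on_matrix_vector_mult[OF D(1) smooth_on_adj3[OF D(1) J] smooth[OF g']])
    \<comment> \<open>\<open>Kd\<close> and \<open>?h\<close> agree on D, which is open, so their
      derivatives agree there as well.\<close>
    then have "frechet_derivative ?h (at x) = frechet_derivative (Kd \<eta> \<zeta> k D \<delta> g) (at x)"
      by (intro frechet_derivative_transform_within_open[OF smooth_on_differentiable D(1) x])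
        (use x in \<open>auto simp: Kd[OF g']\<close>)
    then have "divergence (Kd \<eta> \<zeta> k D \<delta> g) x = divergence ?h x"
      by (simp add: divergence_eq)
    also have "\<dots> = det (KK k \<delta> x) * divergence (conv ?\<psi> (ext0 D g)) (?\<theta> x)"
      unfolding KK_def by (rule divergence_pullback[OF open_UNIV UNIV_I \<theta> dconv[OF g']])
    also have "\<dots> = Kb \<eta> \<zeta> k D \<delta> w x"
      by (simp add: Kb[OF ext(3)] divergence_conv[OF ext(2)[folded weak_div_iff] g' ext(3) \<psi>])
    finally show "divergence (Kd \<eta> \<zeta> k D \<delta> g) x = Kb \<eta> \<zeta> k D \<delta> w x" .
  next
    fix f assume f: "f \<in> Zg p D"
    obtain G where G: "G \<in> Lp p UNIV" "wgrad.weak UNIV (ext0 D f) G" using Zg_D(2)[OF f] by blast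
    note ext = wgrad.weak_ext0_Lp[OF D(1,2) neg G]
    \<comment> \<open>Membership in \<open>Zc\<close> asks for a global Lp curl of the zero
      extension. The zero function is one, because \<open>ext0 D G\<close> is a global weak
      gradient.\<close>
    have "weak_curl UNIV (ext0 D G) (\<lambda>x. 0)"
      by (rule weak_grad_imp_weak_curl_0[OF open_UNIV ext(3)[folded weak_grad_iff]])
    then have "G \<in> Zc p D" using ext(1) Lp_zero by (auto simp: Zc_def)
    then show "\<exists>G\<in>Zc p D. weak_grad D f G" using ext(2) by (auto simp: weak_grad_iff)
  next
    fix g assume g: "g \<in> Zc p D"
    obtain w where w: "w \<in> Lp p UNIV" "wcurl.weak UNIV (ext0 D g) w" using Zc_D(2)[OF g] by blast
    note ext = wcurl.weak_ext0_Lp[OF D(1,2) neg w]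
    have "weak_div UNIV (ext0 D w) (\<lambda>x. 0)"
      by (rule weak_curl_imp_weak_div_0[OF open_UNIV ext(3)[folded weak_curl_iff]])
    then have "w \<in> Zd p D" using ext(1) Lp_zero by (auto simp: Zd_def)
    then show "\<exists>w\<in>Zd p D. weak_curl D g w" using ext(2) by (auto simp: weak_curl_iff)
  next
    fix g assume g: "g \<in> Zd p D"
    obtain w where w: "w \<in> Lp p UNIV" "wdiv.weak UNIV (ext0 D g) w" using Zd_D(2)[OF g] by blast
    note ext = wdiv.weak_ext0_Lp[OF D(1,2) neg w]
    then show "\<exists>w\<in>Lp p D. weak_div D g w" by (auto simp: weak_div_iff)
  next
    show "weak_curl D G (\<lambda>x. 0)" if "weak_grad D f G" for f G
      by (rule weak_grad_imp_weak_curl_0[OF D(1) that])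
  next
    show "weak_div D w (\<lambda>x. 0)" if "weak_curl D g w" for g w
      by (rule weak_curl_imp_weak_div_0[OF D(1) that])
  next
    fix f assume "f \<in> Zg p D"
    note f' = int[OF Zg_D(1)[OF this]]
    show "Kg \<eta> \<zeta> k D \<delta> f \<in> C0_infty D"
      unfolding C0_infty_def using C smooth[OF f'] vanish[OF f']
      by (auto simp: Kg[OF f', abs_def] intro!: exI[of _ C])
  next
    fix g assume "g \<in> Zc p D"
    note g' = int[OF Zc_D(1)[OF this]]
    have "smooth_on D (\<lambda>x. transpose (KK k \<delta> x) *v conv ?\<psi> (ext0 D g) (?\<theta> x))"
      by (rule smooth_on_matrix_vector_mult[OF D(1) _ smooth[OF g']]) (simp add: transpose_def J)
    then show "Kc \<eta> \<zeta> k D \<delta> g \<in> C0_infty D"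
      unfolding C0_infty_def using C vanish[OF g']
      by (auto simp: Kc[OF g', abs_def] intro!: exI[of _ C])
  next
    fix g assume "g \<in> Zd p D"
    note g' = int[OF Zd_D(1)[OF this]]
    have "smooth_on D (\<lambda>x. adj3 (KK k \<delta> x) *v conv ?\<psi> (ext0 D g) (?\<theta> x))"
      by (rule smooth_on_matrix_vector_mult[OF D(1) smooth_on_adj3[OF D(1) J] smooth[OF g']])
    then have "smooth_on D (Kd \<eta> \<zeta> k D \<delta> g)"
      using smooth_on_cong[OF D(1), of "Kd \<eta> \<zeta> k D \<delta> g"] Kd[OF g'] by simp
    then show "Kd \<eta> \<zeta> k D \<delta> g \<in> C0_infty D"
      unfolding C0_infty_def using C vanish[OF g'] Kd[OF g']
      by (auto intro!: exI[of _ C])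
  next
    fix f :: "real^3 \<Rightarrow> real" assume "f \<in> Lp p D"
    note f' = int[OF this]
    have "smooth_on D (\<lambda>x. det (KK k \<delta> x))"
      unfolding det_3 by (intro smooth_on_diff smooth_on_add smooth_on_mult D(1) J)
    then have "smooth_on D (\<lambda>x. det (KK k \<delta> x) * conv ?\<psi> (ext0 D f) (?\<theta> x))"
      by (rule smooth_on_mult[OF D(1) _ smooth[OF f']])
    then show "Kb \<eta> \<zeta> k D \<delta> f \<in> C0_infty D"
      unfolding C0_infty_def using C vanish[OF f']
      by (auto simp: Kb[OF f', abs_def] intro!: exI[of _ C])
  next
    show "grad u \<in> C0_infty D" if "u \<in> C0_infty D" for u
      by (rule C0_infty_grad[OF D(1) that])
  next
    show "curl g \<in> C0_infty D" if "g \<in> C0_infty D" for g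
      by (rule C0_infty_curl[OF D(1) that])
  next
    show "divergence g \<in> C0_infty D" if "g \<in> C0_infty D" for g
      by (rule C0_infty_divergence[OF D(1) that])
  next
    show "curl (grad u) x = 0" if "u \<in> C0_infty D" "x \<in> D" for u x
      by (rule curl_grad[OF D(1) that(2) C0_inftyD[OF that(1)]])
  next
    show "divergence (curl g) x = 0" if "g \<in> C0_infty D" "x \<in> D" for g x
      by (rule div_curl[OF D(1) that(2) C0_inftyD[OF that(1)]])
  qed
qed

end
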